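(* Suppose that $\mathbf{\Gamma}=(\Gamma,<,+,\ldots)$ is an o-minimal expansion of an ordered group $(\Gamma,<,+)$. Let $Z$ be a definably locally closed subset of $\Gamma_\infty^m$. Then $Z$ is the union of finitely many relatively open definable subsets which are definably normal.
   Context: $\Gamma_\infty=\Gamma\cup\{\infty\}$ with $x<\infty$ for all $x\in\Gamma$. For $X\subseteq\Gamma_\infty^m$ and $L\subseteq\{1,\dots,m\}$ let $X_L$ be the set of $x\in X$ whose set of coordinates different from $\infty$ is exactly $L$, and $\tau_L$ the projection onto the coordinates in $L$. $X$ is definable (in the structure $\mathbf{\Gamma}_\infty$) iff $\tau_L(X_L)\subseteq\Gamma^{|L|}$ is definable in $\mathbf{\Gamma}$ for all $L$. $\Gamma_\infty$ has the topology generated by the intervals $(-\infty,a),(a,b),(b,\infty]$ with $a,b\in\Gamma$, $\Gamma_\infty^m$ has the product topology, and subsets the induced topology. A definable subset of $\Gamma_\infty^m$ is definably locally closed if it is the intersection of an open definable and a closed definable subset of $\Gamma_\infty^m$. A definable set $X$ with the induced topology is definably normal if any two disjoint (relatively) closed definable subsets of $X$ can be separated by disjoint (relatively) open definable subsets of $X$. *)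

theory Defs
  imports "HOL-Analysis.Analysis"
begin

text \<open>Ordered groups, not assumed commutative; the library only has the commutative class.\<close>

class linordered_group_add = group_add + linorder +
  assumes group_add_left_mono: "a \<le> b \<Longrightarrow> c + a \<le> c + b"
    and group_add_right_mono: "a \<le> b \<Longrightarrow> a + c \<le> b + c"


section \<open>First-order expansions of an ordered group\<close>

text \<open>
  The language consists of \<open><\<close>, \<open>+\<close> and arbitrary further function symbols \<open>'f\<close> and relation
  symbols \<open>'r\<close>. Symbols are variadic: a symbol used with arguments of different lengths stands for a
  family of symbols, one for each arity.
\<close>

datatype 'f trm = Var nat | Plus "'f trm" "'f trm" | Fn 'f "'f trm list"

datatype ('f, 'r) fm =
    Eq "'f trm" "'f trm"
  | Less "'f trm" "'f trm"
  | Rel 'r "'f trm list"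
  | Neg "('f, 'r) fm"
  | Conj "('f, 'r) fm" "('f, 'r) fm"
  | Ex nat "('f, 'r) fm"

record ('f, 'r, 'g) expansion =
  fn_of :: "'f \<Rightarrow> 'g list \<Rightarrow> 'g"
  rel_of :: "'r \<Rightarrow> 'g list \<Rightarrow> bool"

primrec val :: "('f, 'r, 'g::linordered_group_add) expansion \<Rightarrow> (nat \<Rightarrow> 'g) \<Rightarrow> 'f trm \<Rightarrow> 'g" where
  "val M e (Var i) = e i"
| "val M e (Plus s t) = val M e s + val M e t"
| "val M e (Fn f ts) = fn_of M f (map (val M e) ts)"

primrec sat :: "('f, 'r, 'g::linordered_group_add) expansion \<Rightarrow> (nat \<Rightarrow> 'g) \<Rightarrow> ('f, 'r) fm \<Rightarrow> bool" where
  "sat M e (Eq s t) \<longleftrightarrow> val M e s = val M e t"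
| "sat M e (Less s t) \<longleftrightarrow> val M e s < val M e t"
| "sat M e (Rel r ts) \<longleftrightarrow> rel_of M r (map (val M e) ts)"
| "sat M e (Neg p) \<longleftrightarrow> \<not> sat M e p"
| "sat M e (Conj p q) \<longleftrightarrow> sat M e p \<and> sat M e q"
| "sat M e (Ex i p) \<longleftrightarrow> (\<exists>a. sat M (e(i := a)) p)"

text \<open>
  The power \<open>\<Gamma>\<^bsup>|L|\<^esup>\<close> is \<open>L \<rightarrow>\<^sub>E UNIV\<close>, i.e. coordinates keep their names in \<open>L\<close> instead of being
  renumbered. Definable means definable with parameters: the variables in \<open>L\<close> range over the
  coordinates, and the values of \<open>c\<close> at the remaining variables are the parameters.
\<close>

definition definable ::
    "('f, 'r, 'g::linordered_group_add) expansion \<Rightarrow> nat set \<Rightarrow> (nat \<Rightarrow> 'g) set \<Rightarrow> bool" where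
  "definable M L S \<longleftrightarrow>
     (\<exists>p c. S = {x \<in> L \<rightarrow>\<^sub>E UNIV. sat M (override_on c x L) p})"

definition point_or_open_interval :: "'g::linorder set \<Rightarrow> bool" where
  "point_or_open_interval J \<longleftrightarrow>
     (\<exists>a. J = {a}) \<or> (\<exists>a b. J = {a<..<b}) \<or> (\<exists>a. J = {..<a}) \<or> (\<exists>a. J = {a<..}) \<or> J = UNIV"

text \<open>Here \<open>\<Gamma>\<close> is identified with \<open>{0} \<rightarrow>\<^sub>E UNIV\<close>.\<close>

definition o_minimal :: "('f, 'r, 'g::linordered_group_add) expansion \<Rightarrow> bool" where
  "o_minimal M \<longleftrightarrow>
     (\<forall>S. definable M {0} S \<longrightarrow>
        (\<exists>F. finite F \<and> (\<forall>J\<in>F. point_or_open_interval J) \<and> (\<lambda>x. x 0) ` S = \<Union>F))"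


section \<open>The structure on \<open>\<Gamma>\<^sub>\<infinity>\<close>\<close>

datatype 'g with_infty = Fin (the_fin: 'g) | Infty

instantiation with_infty :: (linorder) linorder
begin

definition less_eq_with_infty :: "'a with_infty \<Rightarrow> 'a with_infty \<Rightarrow> bool" where
  "x \<le> y \<longleftrightarrow> (case y of Infty \<Rightarrow> True | Fin b \<Rightarrow> (case x of Infty \<Rightarrow> False | Fin a \<Rightarrow> a \<le> b))"

definition less_with_infty :: "'a with_infty \<Rightarrow> 'a with_infty \<Rightarrow> bool" where
  "x < y \<longleftrightarrow> (case x of Infty \<Rightarrow> False | Fin a \<Rightarrow> (case y of Infty \<Rightarrow> True | Fin b \<Rightarrow> a < b))"

instance
  by standard (auto simp: less_eq_with_infty_def less_with_infty_def split: with_infty.splits)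

end

text \<open>\<open>\<Gamma>\<^sub>\<infinity>\<^sup>m\<close> is the set \<open>{..<m} \<rightarrow>\<^sub>E UNIV\<close>.\<close>

definition part_at :: "nat \<Rightarrow> nat set \<Rightarrow> (nat \<Rightarrow> 'g with_infty) set \<Rightarrow> (nat \<Rightarrow> 'g with_infty) set" where
  "part_at m L X = {x \<in> X. {i. i < m \<and> x i \<noteq> Infty} = L}"

definition fin_proj :: "nat set \<Rightarrow> (nat \<Rightarrow> 'g with_infty) \<Rightarrow> nat \<Rightarrow> 'g" where
  "fin_proj L x = (\<lambda>i\<in>L. the_fin (x i))"

definition definable_inf ::
    "('f, 'r, 'g::linordered_group_add) expansion \<Rightarrow> nat \<Rightarrow> (nat \<Rightarrow> 'g with_infty) set \<Rightarrow> bool" where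
  "definable_inf M m X \<longleftrightarrow>
     X \<subseteq> {..<m} \<rightarrow>\<^sub>E UNIV \<and> (\<forall>L \<subseteq> {..<m}. definable M L (fin_proj L ` part_at m L X))"

text \<open>
  The whole space is listed among the generators because the intervals fail to cover \<open>\<Gamma>\<^sub>\<infinity>\<close> when
  \<open>\<Gamma>\<close> is the trivial group.
\<close>

definition top_inf :: "'g::linorder with_infty topology" where
  "top_inf = topology_generated_by
     (insert UNIV
       (range (\<lambda>a. {..<Fin a}) \<union> {{Fin a<..<Fin b} |a b. True} \<union> range (\<lambda>b. {Fin b<..})))"

definition top_inf_power :: "nat \<Rightarrow> (nat \<Rightarrow> 'g::linorder with_infty) topology" where
  "top_inf_power m = product_topology (\<lambda>_. top_inf) {..<m}"

definition definably_locally_closed ::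
    "('f, 'r, 'g::linordered_group_add) expansion \<Rightarrow> nat \<Rightarrow> (nat \<Rightarrow> 'g with_infty) set \<Rightarrow> bool" where
  "definably_locally_closed M m Z \<longleftrightarrow>
     (\<exists>U C. openin (top_inf_power m) U \<and> definable_inf M m U \<and>
            closedin (top_inf_power m) C \<and> definable_inf M m C \<and> Z = U \<inter> C)"

definition definably_normal ::
    "('f, 'r, 'g::linordered_group_add) expansion \<Rightarrow> nat \<Rightarrow> (nat \<Rightarrow> 'g with_infty) set \<Rightarrow> bool" where
  "definably_normal M m X \<longleftrightarrow>
     definable_inf M m X \<and>
     (\<forall>A B. closedin (subtopology (top_inf_power m) X) A \<and> definable_inf M m A \<and>
            closedin (subtopology (top_inf_power m) X) B \<and> definable_inf M m B \<and> A \<inter> B = {} \<longrightarrow>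
        (\<exists>U V. openin (subtopology (top_inf_power m) X) U \<and> definable_inf M m U \<and>
               openin (subtopology (top_inf_power m) X) V \<and> definable_inf M m V \<and>
               A \<subseteq> U \<and> B \<subseteq> V \<and> U \<inter> V = {}))"

end

theory Submission
  imports Defs
begin

text \<open>
  Write \<open>Z = U \<inter> C\<close> with \<open>U\<close> open and \<open>C\<close> closed, and for a set
  \<open>J\<close> of coordinates let \<open>\<pi>\<^sub>J x\<close> (\<open>project\<close>) be the point
  \<open>x\<close> with all coordinates outside \<open>J\<close> replaced by \<open>\<infinity>\<close>. The
  set \<open>Z\<close> itself need not be definably normal. Remove \<open>(0, \<infinity>)\<close> from
  \<open>\<Gamma>\<^sub>\<infinity>\<^sup>2\<close>: the closed sets \<open>{(x, \<infinity>). x > 0}\<close>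
  and \<open>{(0, y). y < \<infinity>}\<close> are separated only with the help of a definable function that
  tends to \<open>\<infinity>\<close> at \<open>0\<close>, and a pure ordered vector space over the rationals
  has none. The trouble is that sending the second coordinate of \<open>(0, y)\<close> to
  \<open>\<infinity>\<close> leads out of the open set.

  So let \<open>W\<^sub>L\<close> (\<open>tame_part\<close>) consist of the points \<open>x\<close> of
  \<open>C\<close> that are finite on \<open>L\<close> and satisfy \<open>\<pi>\<^sub>J x \<in> U\<close> for
  all \<open>J \<supseteq> L\<close>. It is relatively open and definable in \<open>Z\<close>, and a point of
  \<open>Z\<close> with finite coordinates exactly \<open>L\<close> lies in \<open>W\<^sub>L\<close>, since
  then \<open>\<pi>\<^sub>J x = x\<close> for \<open>J \<supseteq> L\<close>. Hence the finitely many
  \<open>W\<^sub>L\<close> cover \<open>Z\<close>.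

  To separate disjoint closed subsets \<open>A\<close>, \<open>B\<close> of \<open>W\<^sub>L\<close>, use the
  basic neighbourhoods \<open>N(a, r, t)\<close> (\<open>nbhd\<close>), in which the finite coordinates of
  \<open>a\<close> are within \<open>r\<close> and the others are above \<open>t\<close>. For \<open>x \<in> A
  \<union> B\<close> each \<open>\<pi>\<^sub>J x\<close> is outside the closed set \<open>C\<close> or in
  \<open>W\<^sub>L\<close>, so some neighbourhood of it misses \<open>A\<close> or misses \<open>B\<close>.
  Call \<open>r\<close> separating at \<open>x\<close> (\<open>sep_radius\<close>) if it serves as the radius
  for all \<open>J \<supseteq> L\<close>. A separating radius stays so under the maps
  \<open>\<pi>\<^sub>J\<close> and, up to a factor of two, when the finite coordinates move by less than
  itself. Surround each \<open>a \<in> A\<close> by all \<open>N(a, r, t)\<close> where \<open>8r\<close> is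
  separating at \<open>a\<close> and \<open>t\<close> is so large that \<open>N(a, s, t)\<close> misses
  \<open>B\<close> for \<^emph>\<open>every\<close> \<open>s\<close> such that \<open>2s\<close> is
  separating; do the same for \<open>B\<close> (\<open>tube\<close>). If such neighbourhoods of
  \<open>a\<close> and \<open>b\<close> met, where every finite coordinate of \<open>a\<close> is finite in
  \<open>b\<close>, let \<open>K\<close> be the set of finite coordinates of \<open>a\<close> and \<open>r\<close> the larger of the two
  radii: \<open>4r\<close> would be separating at \<open>a\<close>, by passing from \<open>b\<close> through
  \<open>\<pi>\<^sub>K b\<close> to \<open>a\<close>, and \<open>b\<close> would lie in \<open>N(a, 2r, t)\<close>, which misses
  \<open>B\<close> (\<open>tubes_meet_aux\<close>). If neither set of finite coordinates contains the other,
  it suffices that \<open>t\<close> exceeds the finite coordinates of the centre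
  (\<open>tubes_disjoint\<close>).

  O-minimality enters twice: radii can be halved, and among the bounded definable set of admissible radii
  there is one that is at least half of each other one, so that a single neighbourhood provides a
  \<open>t\<close> for all of them (\<open>threshold_exists\<close>). In the trivial group, where there are no
  radii, \<open>Z\<close> is finite and is covered by the least neighbourhoods of its points. Definability of
  all these sets is read off from their definitions by the closure rules for \<open>config_definable\<close>.
\<close>

section \<open>Ordered groups\<close>

lemma group_less_left [simp]: "c + a < c + b \<longleftrightarrow> a < b" for a b c :: "'g::linordered_group_add"
  by (metis add_left_cancel group_add_left_mono linorder_not_le order_le_less)

lemma group_less_right [simp]: "a + c < b + c \<longleftrightarrow> a < b" for a b c :: "'g::linordered_group_add"
  by (metis add_right_cancel group_add_right_mono linorder_not_le order_le_less)

lemma group_le_left [simp]: "c + a \<le> c + b \<longleftrightarrow> a \<le> b" for a b c :: "'g::linordered_group_add"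
  by (meson group_less_left not_le)

lemma group_le_right [simp]: "a + c \<le> b + c \<longleftrightarrow> a \<le> b" for a b c :: "'g::linordered_group_add"
  by (meson group_less_right not_le)

lemma group_less_self_right [simp]: "a < a + c \<longleftrightarrow> 0 < c" for a c :: "'g::linordered_group_add"
  using group_less_left[of a 0 c] by simp

lemma group_less_self_left [simp]: "a < c + a \<longleftrightarrow> 0 < c" for a c :: "'g::linordered_group_add"
  using group_less_right[of 0 a c] by simp

lemma group_diff_less_iff: "a - c < b \<longleftrightarrow> a < b + c" for a b c :: "'g::linordered_group_add"
  using group_less_right[of "a - c" c b] by simp

lemma group_add_mono: "a \<le> b \<Longrightarrow> c \<le> d \<Longrightarrow> a + c \<le> b + d" for a b c d :: "'g::linordered_group_add"
  by (meson group_add_left_mono group_add_right_mono order_trans)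

lemma group_add_less_le: "a < b \<Longrightarrow> c \<le> d \<Longrightarrow> a + c < b + d" for a b c d :: "'g::linordered_group_add"
  by (meson group_add_left_mono group_less_right less_le_trans)

lemma group_double_pos [simp]: "0 < r + r \<longleftrightarrow> 0 < r" for r :: "'g::linordered_group_add"
  by (metis add.left_neutral group_add_mono group_less_self_right not_less order.strict_trans)

section \<open>First-order definable predicates\<close>

primrec rename_trm :: "(nat \<Rightarrow> nat) \<Rightarrow> 'f trm \<Rightarrow> 'f trm" where
  "rename_trm f (Var i) = Var (f i)"
| "rename_trm f (Plus s t) = Plus (rename_trm f s) (rename_trm f t)"
| "rename_trm f (Fn g ts) = Fn g (map (rename_trm f) ts)"

primrec rename_fm :: "(nat \<Rightarrow> nat) \<Rightarrow> ('f, 'r) fm \<Rightarrow> ('f, 'r) fm" where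
  "rename_fm f (Eq s t) = Eq (rename_trm f s) (rename_trm f t)"
| "rename_fm f (Less s t) = Less (rename_trm f s) (rename_trm f t)"
| "rename_fm f (Rel r ts) = Rel r (map (rename_trm f) ts)"
| "rename_fm f (Neg p) = Neg (rename_fm f p)"
| "rename_fm f (Conj p q) = Conj (rename_fm f p) (rename_fm f q)"
| "rename_fm f (Ex i p) = Ex (f i) (rename_fm f p)"

lemma val_rename: "val M e (rename_trm f t) = val M (e \<circ> f) t"
proof (induction t)
  case (Fn g ts)
  then have "map (\<lambda>t. val M e (rename_trm f t)) ts = map (val M (e \<circ> f)) ts"
    by (intro map_cong refl)
  then show ?case by (simp only: rename_trm.simps val.simps map_map comp_def[of "val M e"])
qed auto

text \<open>
  Injectivity keeps a renamed quantifier from capturing another variable.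
\<close>

lemma sat_rename:
  assumes "inj f"
  shows "sat M e (rename_fm f p) \<longleftrightarrow> sat M (e \<circ> f) p"
proof (induction p arbitrary: e)
  case (Rel r ts)
  have "map (val M e \<circ> rename_trm f) ts = map (val M (e \<circ> f)) ts" by (simp add: val_rename)
  then show ?case by (simp only: rename_fm.simps sat.simps map_map)
next
  case (Ex i p)
  have "e(f i := a) \<circ> f = (e \<circ> f)(i := a)" for a
    using assms by (auto simp: fun_eq_iff inj_eq)
  then show ?case by (simp only: rename_fm.simps sat.simps Ex)
qed (auto simp: val_rename)

text \<open>
  Formulas carry their parameters in the same environment as their variables. Placing the variables at
  the even and the parameters at the odd positions keeps infinitely many positions free for both, so
  that the parameters of two formulas can be combined by renaming.
\<close>

definition interleave :: "(nat \<Rightarrow> 'a) \<Rightarrow> (nat \<Rightarrow> 'a) \<Rightarrow> nat \<Rightarrow> 'a" where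
  "interleave e c j = (if even j then e (j div 2) else c (j div 2))"

text \<open>
  Definability with parameters as a property of predicates of infinite environments. Unlike \<open>definable\<close> it
  does not fix the set of variables, and so it is closed under the logical connectives.
\<close>

definition env_definable :: "('f, 'r, 'g::linordered_group_add) expansion \<Rightarrow> ((nat \<Rightarrow> 'g) \<Rightarrow> bool) \<Rightarrow> bool" where
  "env_definable M P \<longleftrightarrow> (\<exists>p c. \<forall>e. P e \<longleftrightarrow> sat M (interleave e c) p)"

lemma env_definableI:
  assumes "inj f" and "\<And>e. P e \<longleftrightarrow> sat M (interleave e c \<circ> f) p"
  shows "env_definable M P"
  unfolding env_definable_def using sat_rename[OF assms(1)] assms(2) by metis

lemma env_atom: "env_definable M P" if "\<And>e c. P e \<longleftrightarrow> sat M (interleave e c) p"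
  unfolding env_definable_def using that by blast

lemma env_neg: "env_definable M P \<Longrightarrow> env_definable M (\<lambda>e. \<not> P e)"
  unfolding env_definable_def by (metis sat.simps(4))

lemma env_conj:
  assumes "env_definable M P" "env_definable M Q"
  shows "env_definable M (\<lambda>e. P e \<and> Q e)"
proof -
  obtain p c q d where p: "\<And>e. P e \<longleftrightarrow> sat M (interleave e c) p"
    and q: "\<And>e. Q e \<longleftrightarrow> sat M (interleave e d) q"
    using assms unfolding env_definable_def by metis
  \<comment> \<open>The parameters of the first formula move to the positions \<open>4i + 1\<close>, those of the second to \<open>4i + 3\<close>.\<close>
  define f1 where "f1 j = (if even j then j else 2 * j - 1)" for j :: nat
  define f2 where "f2 j = (if even j then j else 2 * j + 1)" for j :: nat
  have inj: "inj f1" "inj f2"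
    unfolding inj_def f1_def f2_def by (auto split: if_splits; presburger)+
  have 1: "interleave e (interleave c d) \<circ> f1 = interleave e c" for e
  proof
    fix j show "(interleave e (interleave c d) \<circ> f1) j = interleave e c j"
    proof (cases "even j")
      case False
      then obtain b where b: "j = 2 * b + 1" by (rule oddE)
      have "f1 j = 2 * (2 * b) + 1" "(2 * (2 * b) + 1) div 2 = 2 * b"
        unfolding f1_def b by simp_all
      then show ?thesis using b by (simp add: interleave_def)
    qed (simp add: interleave_def f1_def)
  qed
  have 2: "interleave e (interleave c d) \<circ> f2 = interleave e d" for e
  proof
    fix j show "(interleave e (interleave c d) \<circ> f2) j = interleave e d j"
    proof (cases "even j")
      case False
      then obtain b where b: "j = 2 * b + 1" by (rule oddE)
      have "f2 j = 2 * (2 * b + 1) + 1" "(2 * (2 * b + 1) + 1) div 2 = 2 * b + 1"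
        unfolding f2_def b by simp_all
      then show ?thesis using b by (simp add: interleave_def)
    qed (simp add: interleave_def f2_def)
  qed
  have "P e \<and> Q e \<longleftrightarrow>
      sat M (interleave e (interleave c d)) (Conj (rename_fm f1 p) (rename_fm f2 q))" for e
    by (simp add: sat_rename inj 1 2 p q)
  then show ?thesis unfolding env_definable_def by blast
qed

lemma env_ex:
  assumes "env_definable M P"
  shows "env_definable M (\<lambda>e. \<exists>a. P (e(i := a)))"
proof -
  obtain p c where p: "\<And>e. P e \<longleftrightarrow> sat M (interleave e c) p"
    using assms unfolding env_definable_def by metis
  have "interleave (e(i := a)) c = (interleave e c)(2 * i := a)" for e a
    by (auto simp: interleave_def fun_eq_iff)
  then have "(\<exists>a. P (e(i := a))) \<longleftrightarrow> sat M (interleave e c) (Ex (2 * i) p)" for e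
    by (simp add: p)
  then show ?thesis unfolding env_definable_def by blast
qed

lemma env_const: "env_definable M (\<lambda>e. b)"
proof -
  have "env_definable M (\<lambda>e. True)" by (rule env_atom[of _ _ "Eq (Var 0) (Var 0)"]) simp
  moreover have "env_definable M (\<lambda>e. False)" by (rule env_atom[of _ _ "Neg (Eq (Var 0) (Var 0))"]) simp
  ultimately show ?thesis by (cases b) auto
qed

lemma env_disj: "env_definable M P \<Longrightarrow> env_definable M Q \<Longrightarrow> env_definable M (\<lambda>e. P e \<or> Q e)"
  using env_neg[OF env_conj[OF env_neg env_neg], of M P Q] by simp

lemma env_of_definable:
  assumes "definable M K S" "inj g"
  shows "env_definable M (\<lambda>e. restrict (\<lambda>i. e (g i)) K \<in> S)"
proof -
  obtain p c where S: "S = {x \<in> K \<rightarrow>\<^sub>E UNIV. sat M (override_on c x K) p}"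
    using assms(1) unfolding definable_def by blast
  define f where "f i = (if i \<in> K then 2 * g i else 2 * i + 1)" for i
  have "inj f"
    unfolding inj_def f_def using assms(2) by (auto simp: inj_eq; presburger)
  moreover have "override_on c (restrict (\<lambda>i. e (g i)) K) K = interleave e c \<circ> f" for e
    by (auto simp: override_on_def interleave_def f_def fun_eq_iff)
  then have "restrict (\<lambda>i. e (g i)) K \<in> S \<longleftrightarrow> sat M (interleave e c \<circ> f) p" for e
    unfolding S by simp
  ultimately show ?thesis by (rule env_definableI)
qed

text \<open>
  The return to \<open>definable\<close>: variable \<open>g i\<close> of the predicate becomes coordinate \<open>i\<close>, and all
  remaining positions, variables and parameters alike, are moved out of the way of \<open>K\<close> to become parameters.
  The default values \<open>d\<close> thus turn environment entries into parameters.
\<close>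

lemma definable_of_env:
  assumes "env_definable M P" "finite K" "inj_on g K"
    and "\<And>y i. i \<in> K \<Longrightarrow> h y (g i) = y i" and "\<And>y j. j \<notin> g ` K \<Longrightarrow> h y j = d j"
  shows "definable M K {y \<in> K \<rightarrow>\<^sub>E UNIV. P (h y)}"
proof -
  obtain p c where p: "\<And>e. P e \<longleftrightarrow> sat M (interleave e c) p"
    using assms unfolding env_definable_def by metis
  obtain N where N: "K \<subseteq> {..<N}"
    using assms(2) finite_nat_iff_bounded by blast
  define f where
    "f j = (if even j \<and> j div 2 \<in> g ` K then the_inv_into K g (j div 2) else N + j)" for j
  define c' where "c' k = interleave d c (k - N)" for k
  have inK: "the_inv_into K g (j div 2) \<in> K" if "j div 2 \<in> g ` K" for j
    using that assms(3) by (simp add: the_inv_into_into)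
  have "inj f"
  proof (rule injI)
    fix i j assume eq: "f i = f j"
    have lt: "the_inv_into K g (j div 2) < N" if "j div 2 \<in> g ` K" for j
      using inK[OF that] N by auto
    have "even i \<and> i div 2 \<in> g ` K \<longleftrightarrow> even j \<and> j div 2 \<in> g ` K"
      using eq lt[of i] lt[of j] unfolding f_def by (auto split: if_splits)
    moreover have "i div 2 = j div 2"
      if "the_inv_into K g (i div 2) = the_inv_into K g (j div 2)" "i div 2 \<in> g ` K" "j div 2 \<in> g ` K"
      using that assms(3) by (metis f_the_inv_into_f)
    ultimately show "i = j"
      using eq unfolding f_def by (auto split: if_splits elim!: evenE)
  qed
  moreover have "override_on c' y K \<circ> f = interleave (h y) c" for y
  proof
    fix j
    show "(override_on c' y K \<circ> f) j = interleave (h y) c j"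
    proof (cases "even j \<and> j div 2 \<in> g ` K")
      case True
      then have "h y (g (the_inv_into K g (j div 2))) = y (the_inv_into K g (j div 2))"
        using assms(4) inK by blast
      then show ?thesis
        using True inK assms(3) by (auto simp: interleave_def f_def override_on_def f_the_inv_into_f)
    next
      case False
      then have "N + j \<notin> K" using N by auto
      then show ?thesis
        using False assms(5) by (auto simp: interleave_def f_def override_on_def c'_def)
    qed
  qed
  ultimately have "P (h y) \<longleftrightarrow> sat M (override_on c' y K) (rename_fm f p)" for y
    by (simp add: p sat_rename)
  then show ?thesis unfolding definable_def by blast
qed

section \<open>Definable predicates of points of \<open>\<Gamma>\<^sub>\<infinity>\<^sup>m\<close> and of elements of \<open>\<Gamma>\<close>\<close>

type_synonym 'g point = "nat \<Rightarrow> 'g with_infty"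

text \<open>
  A configuration consists of points \<open>E 0\<close>, \<open>E 1\<close>, \<open>\<dots>\<close> of \<open>\<Gamma>\<^sub>\<infinity>\<^sup>m\<close> and of
  scalars \<open>s 0\<close>, \<open>s 1\<close>, \<open>\<dots>\<close> in \<open>\<Gamma>\<close>. It is coded by one environment over \<open>\<Gamma>\<close> together with the set \<open>L\<close>
  of the coordinates that are finite; an infinite coordinate ignores its entry.
\<close>

definition scalars :: "(nat \<Rightarrow> 'g) \<Rightarrow> nat \<Rightarrow> 'g" where
  "scalars e k = e (2 * k)"

definition points :: "(nat \<times> nat) set \<Rightarrow> (nat \<Rightarrow> 'g) \<Rightarrow> nat \<Rightarrow> 'g point" where
  "points L e p i = (if (p, i) \<in> L then Fin (e (2 * prod_encode (p, i) + 1)) else Infty)"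

text \<open>
  As for \<open>definable_inf\<close>, definability is demanded separately for each pattern of finite coordinates. The second
  conjunct says that coordinates from \<open>m\<close> on are ignored, so that a quantifier over a point amounts to \<open>m\<close>
  quantifiers over coordinates.
\<close>

definition config_definable :: "('f, 'r, 'g::linordered_group_add) expansion \<Rightarrow> nat \<Rightarrow>
    ((nat \<Rightarrow> 'g point) \<Rightarrow> (nat \<Rightarrow> 'g) \<Rightarrow> bool) \<Rightarrow> bool" where
  "config_definable M m Q \<longleftrightarrow> (\<forall>L. env_definable M (\<lambda>e. Q (points L e) (scalars e))) \<and>
     (\<forall>E E' s. (\<forall>p. \<forall>i<m. E p i = E' p i) \<longrightarrow> Q E s = Q E' s)"

lemma points_scalars_surj:
  obtains L e where "points L e = E" "scalars e = s"
proof
  define L where "L = {(p, i). E p i \<noteq> Infty}"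
  define e where "e j = (if even j then s (j div 2)
    else the_fin (case prod_decode (j div 2) of (p, i) \<Rightarrow> E p i))" for j
  have "points L e p i = E p i" for p i
    by (cases "E p i") (auto simp: points_def L_def e_def)
  then show "points L e = E" by blast
  show "scalars e = s"
    by (auto simp: scalars_def e_def)
qed

lemma config_local:
  assumes "config_definable M m Q" "\<And>p i. i < m \<Longrightarrow> E p i = E' p i"
  shows "Q E s = Q E' s"
proof -
  have "\<forall>p. \<forall>i<m. E p i = E' p i" using assms(2) by simp
  then show ?thesis
    using assms(1)[unfolded config_definable_def, THEN conjunct2, rule_format, of E E' s] by (simp only:)
qed

lemma config_const: "config_definable M m (\<lambda>E s. b)"
  by (simp add: config_definable_def env_const)

lemma config_neg:
  fixes M :: "('f, 'r, 'g::linordered_group_add) expansion"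
  assumes "config_definable M m Q"
  shows "config_definable M m (\<lambda>E s. \<not> Q E s)"
  unfolding config_definable_def
proof (intro conjI allI impI)
  show "env_definable M (\<lambda>e. \<not> Q (points L e) (scalars e))" for L
    using assms by (intro env_neg) (simp add: config_definable_def)
next
  fix E E' :: "nat \<Rightarrow> 'g point" and s
  assume "\<forall>p. \<forall>i<m. E p i = E' p i"
  then have "Q E s = Q E' s"
    by (auto intro!: config_local[OF assms])
  then show "(\<not> Q E s) = (\<not> Q E' s)" by simp
qed

lemma config_conj:
  fixes M :: "('f, 'r, 'g::linordered_group_add) expansion"
  assumes "config_definable M m P" "config_definable M m Q"
  shows "config_definable M m (\<lambda>E s. P E s \<and> Q E s)"
  unfolding config_definable_def
proof (intro conjI allI impI)
  show "env_definable M (\<lambda>e. P (points L e) (scalars e) \<and> Q (points L e) (scalars e))" for L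
    using assms by (intro env_conj) (simp_all add: config_definable_def)
next
  fix E E' :: "nat \<Rightarrow> 'g point" and s
  assume "\<forall>p. \<forall>i<m. E p i = E' p i"
  then have "P E s = P E' s" "Q E s = Q E' s"
    by (auto intro!: config_local[OF assms(1)] config_local[OF assms(2)])
  then show "(P E s \<and> Q E s) = (P E' s \<and> Q E' s)" by simp
qed

lemma config_disj:
  assumes "config_definable M m P" "config_definable M m Q"
  shows "config_definable M m (\<lambda>E s. P E s \<or> Q E s)"
proof -
  have "config_definable M m (\<lambda>E s. \<not> (\<not> P E s \<and> \<not> Q E s))"
    by (intro config_neg config_conj assms)
  then show ?thesis by simp
qed

lemma config_imp:
  assumes "config_definable M m P" "config_definable M m Q"
  shows "config_definable M m (\<lambda>E s. P E s \<longrightarrow> Q E s)"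
proof -
  have "config_definable M m (\<lambda>E s. \<not> P E s \<or> Q E s)"
    by (intro config_neg config_disj assms)
  then show ?thesis by (simp only: imp_conv_disj)
qed

lemma config_finite_all:
  assumes "finite S" "\<And>j. j \<in> S \<Longrightarrow> config_definable M m (Q j)"
  shows "config_definable M m (\<lambda>E s. \<forall>j\<in>S. Q j E s)"
  using assms by (induction S) (simp_all add: config_const config_conj)

text \<open>
  Over \<open>\<Gamma>\<^sub>\<infinity>\<close> an existential quantifier is a disjunction: the value is \<open>\<infinity>\<close>, which removes the coordinate
  from the pattern, or it is finite, which adds it to the pattern and quantifies over \<open>\<Gamma>\<close>.
\<close>

lemma config_ex_coordinate:
  fixes M :: "('f, 'r, 'g::linordered_group_add) expansion"
  assumes "config_definable M m Q"
  shows "config_definable M m (\<lambda>E s. \<exists>x. Q (E(p := (E p)(i := x))) s)"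
  unfolding config_definable_def
proof (intro conjI allI impI)
  fix L
  let ?j = "2 * prod_encode (p, i) + 1"
  have fin: "(points L e)(p := (points L e p)(i := Fin a)) = points (insert (p, i) L) (e(?j := a))" for e a
    by (auto simp: points_def fun_eq_iff)
  have inf: "(points L e)(p := (points L e p)(i := Infty)) = points (L - {(p, i)}) e" for e
    by (auto simp: points_def fun_eq_iff)
  have sc: "scalars (e(?j := a)) = scalars e" for e :: "nat \<Rightarrow> 'g" and a
  proof
    fix k
    have "2 * k \<noteq> ?j" by presburger
    then show "scalars (e(?j := a)) k = scalars e k" by (simp add: scalars_def)
  qed
  have split: "(\<exists>x. R x) \<longleftrightarrow> R Infty \<or> (\<exists>a. R (Fin a))" for R :: "'g with_infty \<Rightarrow> bool"
    by (metis with_infty.exhaust)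
  have "env_definable M (\<lambda>e. \<exists>a. (\<lambda>e. Q (points (insert (p, i) L) e) (scalars e)) (e(?j := a)))"
    by (rule env_ex) (use assms in \<open>auto simp: config_definable_def\<close>)
  then have "env_definable M (\<lambda>e. \<exists>a. Q (points (insert (p, i) L) (e(?j := a))) (scalars e))"
    by (simp only: sc)
  moreover have "env_definable M (\<lambda>e. Q (points (L - {(p, i)}) e) (scalars e))"
    using assms by (auto simp: config_definable_def)
  ultimately show "env_definable M (\<lambda>e. \<exists>x. Q ((points L e)(p := (points L e p)(i := x))) (scalars e))"
    unfolding split fin inf by (rule env_disj[rotated])
next
  fix E E' :: "nat \<Rightarrow> 'g point" and s
  assume "\<forall>p. \<forall>i<m. E p i = E' p i"
  then have "Q (E(p := (E p)(i := x))) s = Q (E'(p := (E' p)(i := x))) s" for x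
    by (intro config_local[OF assms]) auto
  then show "(\<exists>x. Q (E(p := (E p)(i := x))) s) = (\<exists>x. Q (E'(p := (E' p)(i := x))) s)" by simp
qed

lemma config_ex_point_update:
  fixes M :: "('f, 'r, 'g::linordered_group_add) expansion"
  assumes "config_definable M m Q"
  shows "config_definable M m (\<lambda>E s. \<exists>a. Q (E(p := a)) s)"
proof -
  have "config_definable M m (\<lambda>E s. \<exists>a. Q (E(p := (\<lambda>i. if i < k then a i else E p i))) s)" for k
  proof (induction k)
    case 0
    then show ?case using assms by simp
  next
    case (Suc k)
    have "(\<exists>x a. Q (E(p := (\<lambda>i. if i < k then a i else ((E p)(k := x)) i))) s) \<longleftrightarrow>
        (\<exists>a. Q (E(p := (\<lambda>i. if i < Suc k then a i else E p i))) s)" (is "?l \<longleftrightarrow> ?r") for E s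
    proof
      assume ?l
      then obtain x a where *: "Q (E(p := (\<lambda>i. if i < k then a i else ((E p)(k := x)) i))) s"
        by blast
      have "(\<lambda>i. if i < k then a i else ((E p)(k := x)) i) =
          (\<lambda>i. if i < Suc k then (a(k := x)) i else E p i)"
        by (auto simp: fun_eq_iff)
      then show ?r using * by metis
    next
      assume ?r
      then obtain a where *: "Q (E(p := (\<lambda>i. if i < Suc k then a i else E p i))) s"
        by blast
      have "(\<lambda>i. if i < Suc k then a i else E p i) =
          (\<lambda>i. if i < k then a i else ((E p)(k := a k)) i)"
        by (auto simp: fun_eq_iff less_Suc_eq)
      then show ?l using * by metis
    qed
    then show ?case
      using config_ex_coordinate[OF Suc, of p k] by (simp only: fun_upd_same fun_upd_upd)
  qed
  from this[of m] show ?thesis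
  proof (rule back_subst[where P="config_definable M m"])
    have "Q (E(p := (\<lambda>i. if i < m then a i else E p i))) s = Q (E(p := a)) s" for E s a
      by (rule config_local[OF assms]) auto
    then show "(\<lambda>E s. \<exists>a. Q (E(p := (\<lambda>i. if i < m then a i else E p i))) s) = (\<lambda>E s. \<exists>a. Q (E(p := a)) s)"
      by simp
  qed
qed

text \<open>
  The form of the rule is made for resolution with a goal \<open>\<exists>a. \<Phi> E s a\<close>: the bound point is
  stored in a component of the configuration that \<open>\<Phi>\<close> does not look at.
\<close>

lemma config_ex_point:
  assumes "config_definable M m (\<lambda>E s. \<Phi> E s (E p))" and "\<And>E s a b. \<Phi> (E(p := b)) s a = \<Phi> E s a"
  shows "config_definable M m (\<lambda>E s. \<exists>a. \<Phi> E s a)"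
  using config_ex_point_update[OF assms(1), of p] by (simp add: assms(2))

lemma config_all_point:
  assumes "config_definable M m (\<lambda>E s. \<Phi> E s (E p))" and "\<And>E s a b. \<Phi> (E(p := b)) s a = \<Phi> E s a"
  shows "config_definable M m (\<lambda>E s. \<forall>a. \<Phi> E s a)"
  using config_neg[OF config_ex_point[where \<Phi>="\<lambda>E s a. \<not> \<Phi> E s a" and p=p, OF config_neg[OF assms(1)]]]
  by (simp add: assms(2))

lemma config_ex_scalar:
  fixes M :: "('f, 'r, 'g::linordered_group_add) expansion"
  assumes "config_definable M m (\<lambda>E s. \<Phi> E s (s k))" and "\<And>E s a b. \<Phi> E (s(k := b)) a = \<Phi> E s a"
  shows "config_definable M m (\<lambda>E s. \<exists>a. \<Phi> E s a)"
  unfolding config_definable_def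
proof (intro conjI allI impI)
  fix L
  have pt: "points L (e(2 * k := a)) = points L e" for e :: "nat \<Rightarrow> 'g" and a
    unfolding points_def fun_eq_iff by (auto, presburger)
  have sc: "scalars (e(2 * k := a)) = (scalars e)(k := a)" for e :: "nat \<Rightarrow> 'g" and a
    by (auto simp: scalars_def fun_eq_iff)
  have "env_definable M (\<lambda>e. \<exists>a. (\<lambda>e. \<Phi> (points L e) (scalars e) (scalars e k)) (e(2 * k := a)))"
    by (rule env_ex) (use assms(1) in \<open>auto simp: config_definable_def\<close>)
  then show "env_definable M (\<lambda>e. \<exists>a. \<Phi> (points L e) (scalars e) a)"
    by (simp only: pt sc assms(2) fun_upd_same)
next
  fix E E' :: "nat \<Rightarrow> 'g point" and s
  assume *: "\<forall>p. \<forall>i<m. E p i = E' p i"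
  have "\<Phi> E s a = \<Phi> E' s a" for a
    using config_local[OF assms(1), of E E' "s(k := a)"] * by (simp add: assms(2))
  then show "(\<exists>a. \<Phi> E s a) = (\<exists>a. \<Phi> E' s a)" by simp
qed

lemma config_all_scalar:
  assumes "config_definable M m (\<lambda>E s. \<Phi> E s (s k))" and "\<And>E s a b. \<Phi> E (s(k := b)) a = \<Phi> E s a"
  shows "config_definable M m (\<lambda>E s. \<forall>a. \<Phi> E s a)"
  using config_neg[OF config_ex_scalar[where \<Phi>="\<lambda>E s a. \<not> \<Phi> E s a" and k=k, OF config_neg[OF assms(1)]]]
  by (simp add: assms(2))

definition project :: "nat set \<Rightarrow> 'g point \<Rightarrow> 'g point" where
  "project J a = (\<lambda>i. if i \<in> J then a i else Infty)"

text \<open>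
  Projecting a point only shrinks the pattern of finite coordinates.
\<close>

lemma config_project:
  fixes M :: "('f, 'r, 'g::linordered_group_add) expansion"
  assumes "config_definable M m (\<lambda>E s. \<Phi> E s (E p))" and "\<And>E s a b. \<Phi> (E(p := b)) s a = \<Phi> E s a"
  shows "config_definable M m (\<lambda>E s. \<Phi> E s (project J (E p)))"
proof -
  define Q where "Q E s = \<Phi> E s (E p)" for E s
  have Q: "\<Phi> E s (project J (E p)) = Q (E(p := project J (E p))) s" for E s
    by (simp add: Q_def assms(2))
  have FQ: "config_definable M m Q" using assms(1) by (simp add: Q_def[abs_def])
  have pt: "(points L e)(p := project J (points L e p)) = points (L - {p} \<times> (- J)) e"
    for L and e :: "nat \<Rightarrow> 'g"
    by (auto simp: points_def project_def fun_eq_iff)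
  have "env_definable M (\<lambda>e. Q (points (L - {p} \<times> (- J)) e) (scalars e))" for L
    using FQ by (simp add: config_definable_def)
  moreover have "Q (E(p := project J (E p))) s = Q (E'(p := project J (E' p))) s"
    if "\<forall>p. \<forall>i<m. E p i = E' p i" for E E' s
    by (rule config_local[OF FQ]) (use that in \<open>auto simp: project_def\<close>)
  ultimately show ?thesis
    unfolding config_definable_def Q pt by blast
qed

inductive group_term :: "((nat \<Rightarrow> 'g::plus) \<Rightarrow> 'g) \<Rightarrow> bool" where
  group_term_var [intro, simp]: "group_term (\<lambda>s. s k)"
| group_term_plus [intro, simp]: "group_term \<tau> \<Longrightarrow> group_term \<sigma> \<Longrightarrow> group_term (\<lambda>s. \<tau> s + \<sigma> s)"

lemma group_term_val:
  assumes "group_term \<tau>"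
  shows "\<exists>t. \<forall>e c. \<tau> (scalars e) = val M (interleave e c) t"
  using assms
proof induction
  case (group_term_var k)
  have "scalars e k = val M (interleave e c) (Var (4 * k))" for e c
    by (simp add: scalars_def interleave_def)
  then show ?case by blast
next
  case (group_term_plus \<tau> \<sigma>)
  then obtain t u where "\<forall>e c. \<tau> (scalars e) = val M (interleave e c) t"
    "\<forall>e c. \<sigma> (scalars e) = val M (interleave e c) u" by blast
  then have "\<forall>e c. \<tau> (scalars e) + \<sigma> (scalars e) = val M (interleave e c) (Plus t u)" by simp
  then show ?case by blast
qed

lemma config_less:
  assumes "group_term \<tau>" "group_term \<sigma>"
  shows "config_definable M m (\<lambda>E s. \<tau> s < \<sigma> s)"
proof -
  obtain t where "\<forall>e c. \<tau> (scalars e) = val M (interleave e c) t"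
    using group_term_val[OF assms(1)] by (rule exE)
  moreover obtain u where "\<forall>e c. \<sigma> (scalars e) = val M (interleave e c) u"
    using group_term_val[OF assms(2)] by (rule exE)
  ultimately have "\<tau> (scalars e) < \<sigma> (scalars e) \<longleftrightarrow> sat M (interleave e c) (Less t u)" for e c by simp
  then have "env_definable M (\<lambda>e. \<tau> (scalars e) < \<sigma> (scalars e))" by (rule env_atom)
  then show ?thesis by (simp add: config_definable_def)
qed

lemma config_le:
  assumes "group_term \<tau>" "group_term \<sigma>"
  shows "config_definable M m (\<lambda>E s. \<tau> s \<le> \<sigma> s)"
proof -
  have "config_definable M m (\<lambda>E s. \<not> \<sigma> s < \<tau> s)"
    by (intro config_neg config_less assms)
  then show ?thesis by (simp only: not_less)
qed

lemma less_with_infty_simps [simp]: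
  "Fin a < Fin b \<longleftrightarrow> a < b" "Fin a < Infty" "\<not> Infty < x"
  "Fin a \<le> Fin b \<longleftrightarrow> a \<le> b" "x \<le> Infty" "Infty \<le> Fin a \<longleftrightarrow> False"
  by (auto simp: less_with_infty_def less_eq_with_infty_def split: with_infty.splits)

text \<open>
  Stated with addition on the right only, so that the triangle inequality holds without commutativity.
\<close>

definition near :: "'g::{plus,ord} \<Rightarrow> 'g with_infty \<Rightarrow> 'g with_infty \<Rightarrow> bool" where
  "near r x y \<longleftrightarrow> (case x of Infty \<Rightarrow> False | Fin a \<Rightarrow>
     (case y of Infty \<Rightarrow> False | Fin b \<Rightarrow> a < b + r \<and> b < a + r))"

lemma near_simps [simp]:
  "near r (Fin a) (Fin b) \<longleftrightarrow> a < b + r \<and> b < a + r" "\<not> near r Infty x" "\<not> near r x Infty"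
  by (auto simp: near_def split: with_infty.splits)

lemma config_infinite:
  assumes "i < m"
  shows "config_definable M m (\<lambda>E s. E p i = Infty)"
  unfolding config_definable_def
proof (intro conjI allI impI)
  show "env_definable M (\<lambda>e. points L e p i = Infty)" for L
    by (cases "(p, i) \<in> L") (simp_all add: points_def env_const)
qed (use assms in auto)

lemma config_term_less_coordinate:
  assumes "group_term \<tau>" "i < m"
  shows "config_definable M m (\<lambda>E s. Fin (\<tau> s) < E p i)"
proof -
  obtain t where t: "\<forall>e c. \<tau> (scalars e) = val M (interleave e c) t"
    using group_term_val[OF assms(1)] by (rule exE)
  have "env_definable M (\<lambda>e. Fin (\<tau> (scalars e)) < points L e p i)" for L
  proof (cases "(p, i) \<in> L")
    case True
    have "Fin (\<tau> (scalars e)) < points L e p i \<longleftrightarrow>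
        sat M (interleave e c) (Less t (Var (2 * (2 * prod_encode (p, i) + 1))))" for e c
      using True t by (simp add: points_def) (simp add: interleave_def)
    then show ?thesis by (rule env_atom)
  next
    case False
    then show ?thesis by (simp add: points_def env_const)
  qed
  then show ?thesis using assms(2) by (simp add: config_definable_def)
qed

lemma config_near:
  assumes "group_term \<tau>" "i < m"
  shows "config_definable M m (\<lambda>E s. near (\<tau> s) (E p i) (E q i))"
proof -
  obtain t where t: "\<forall>e c. \<tau> (scalars e) = val M (interleave e c) t"
    using group_term_val[OF assms(1)] by (rule exE)
  let ?v = "\<lambda>p. Var (2 * (2 * prod_encode (p, i) + 1))"
  have "env_definable M (\<lambda>e. near (\<tau> (scalars e)) (points L e p i) (points L e q i))" for L
  proof (cases "(p, i) \<in> L \<and> (q, i) \<in> L")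
    case True
    have "near (\<tau> (scalars e)) (points L e p i) (points L e q i) \<longleftrightarrow>
        sat M (interleave e c) (Conj (Less (?v p) (Plus (?v q) t)) (Less (?v q) (Plus (?v p) t)))" for e c
      using True t by (simp add: points_def) (simp add: interleave_def)
    then show ?thesis by (rule env_atom)
  next
    case False
    then have "(\<lambda>e. near (\<tau> (scalars e)) (points L e p i) (points L e q i)) = (\<lambda>e. False)"
      by (auto simp: points_def)
    then show ?thesis by (simp only: env_const)
  qed
  then show ?thesis using assms(2) by (simp add: config_definable_def)
qed

lemma fin_proj_inj_on:
  "inj_on (fin_proj K) {x \<in> {..<m} \<rightarrow>\<^sub>E UNIV. {i. i < m \<and> x i \<noteq> Infty} = K}"
proof (rule inj_onI)
  fix x y :: "nat \<Rightarrow> 'a with_infty"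
  assume x: "x \<in> {x \<in> {..<m} \<rightarrow>\<^sub>E UNIV. {i. i < m \<and> x i \<noteq> Infty} = K}"
    and y: "y \<in> {x \<in> {..<m} \<rightarrow>\<^sub>E UNIV. {i. i < m \<and> x i \<noteq> Infty} = K}"
    and eq: "fin_proj K x = fin_proj K y"
  have K: "i \<in> K \<longleftrightarrow> x i \<noteq> Infty" "i \<in> K \<longleftrightarrow> y i \<noteq> Infty" if "i < m" for i
    using x y that by blast+
  show "x = y"
  proof (rule PiE_ext)
    show "x \<in> {..<m} \<rightarrow>\<^sub>E UNIV" "y \<in> {..<m} \<rightarrow>\<^sub>E UNIV" using x y by blast+
    fix i assume "i \<in> {..<m}"
    then have i: "i < m" by simp
    show "x i = y i"
    proof (cases "i \<in> K")
      case True
      then have "the_fin (x i) = the_fin (y i)"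
        using fun_cong[OF eq, of i] by (simp add: fin_proj_def)
      then show ?thesis using K[OF i] True by (metis with_infty.exhaust_sel)
    next
      case False
      then show ?thesis using K[OF i] by simp
    qed
  qed
qed

text \<open>
  For a fixed pattern this is the definition of \<open>definable_inf\<close>; \<open>fin_proj\<close> loses no information there.
\<close>

lemma config_mem:
  fixes M :: "('f, 'r, 'g::linordered_group_add) expansion"
  assumes "definable_inf M m X"
  shows "config_definable M m (\<lambda>E s. restrict (E p) {..<m} \<in> X)"
  unfolding config_definable_def
proof (intro conjI allI impI)
  fix L
  define K where "K = {i. i < m \<and> (p, i) \<in> L}"
  define g where "g i = 2 * prod_encode (p, i) + 1" for i
  have "restrict (points L e p) {..<m} \<in> X \<longleftrightarrow>
      restrict (\<lambda>i. e (g i)) K \<in> fin_proj K ` part_at m K X" for e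
  proof -
    let ?x = "restrict (points L e p) {..<m}"
    have K: "{i. i < m \<and> ?x i \<noteq> Infty} = K"
      by (auto simp: K_def points_def)
    have "fin_proj K ?x = restrict (\<lambda>i. e (g i)) K"
      by (auto simp: fin_proj_def K_def points_def g_def fun_eq_iff)
    moreover have "?x \<in> X \<longleftrightarrow> fin_proj K ?x \<in> fin_proj K ` part_at m K X"
    proof
      assume "fin_proj K ?x \<in> fin_proj K ` part_at m K X"
      then obtain y where y: "fin_proj K ?x = fin_proj K y" "y \<in> X" "{i. i < m \<and> y i \<noteq> Infty} = K"
        by (auto simp: part_at_def)
      have "?x = y"
      proof (rule inj_onD[OF fin_proj_inj_on[of K m], of ?x y])
        show "y \<in> {x \<in> {..<m} \<rightarrow>\<^sub>E UNIV. {i. i < m \<and> x i \<noteq> Infty} = K}"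
          using y(2,3) assms unfolding definable_inf_def by blast
      qed (use K y(1) in auto)
      then show "?x \<in> X" using y by simp
    next
      assume "?x \<in> X"
      then have "?x \<in> part_at m K X" using K unfolding part_at_def by blast
      then show "fin_proj K ?x \<in> fin_proj K ` part_at m K X" by (rule imageI)
    qed
    ultimately show ?thesis by (simp only:)
  qed
  moreover have "env_definable M (\<lambda>e. restrict (\<lambda>i. e (g i)) K \<in> fin_proj K ` part_at m K X)"
  proof (rule env_of_definable)
    have "K \<subseteq> {..<m}" by (auto simp: K_def)
    then show "definable M K (fin_proj K ` part_at m K X)"
      using assms unfolding definable_inf_def by blast
    show "inj g" by (auto simp: g_def inj_def)
  qed
  ultimately show "env_definable M (\<lambda>e. restrict (points L e p) {..<m} \<in> X)" by (simp only:)
next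
  fix E E' :: "nat \<Rightarrow> 'g point" and s :: "nat \<Rightarrow> 'g"
  assume "\<forall>p. \<forall>i<m. E p i = E' p i"
  then have "restrict (E p) {..<m} = restrict (E' p) {..<m}" by (auto simp: fun_eq_iff)
  then show "(restrict (E p) {..<m} \<in> X) = (restrict (E' p) {..<m} \<in> X)" by simp
qed

text \<open>
  The values of the scalars become parameters.
\<close>

lemma definable_inf_of_config:
  fixes M :: "('f, 'r, 'g::linordered_group_add) expansion"
  assumes "config_definable M m (\<lambda>E s. \<Phi> s (E p))"
  shows "definable_inf M m {x \<in> {..<m} \<rightarrow>\<^sub>E UNIV. \<Phi> s x}"
  unfolding definable_inf_def
proof (intro conjI allI impI)
  let ?X = "{x \<in> {..<m} \<rightarrow>\<^sub>E UNIV. \<Phi> s x}"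
  show "?X \<subseteq> {..<m} \<rightarrow>\<^sub>E UNIV" by blast
  fix K :: "nat set"
  assume K: "K \<subseteq> {..<m}"
  define g where "g i = 2 * prod_encode (p, i) + 1" for i
  define d where "d j = s (j div 2)" for j
  define h where "h y j = (if j \<in> g ` K then y (the_inv_into K g j) else d j)" for y :: "nat \<Rightarrow> 'g" and j
  have inj: "inj_on g K" by (auto simp: g_def inj_on_def)
  have hg: "h y (g i) = y i" if "i \<in> K" for y i
    using that inj by (auto simp: h_def the_inv_into_f_f)
  have sc: "scalars (h y) = s" for y
  proof
    fix k
    have "2 * k \<notin> g ` K" unfolding g_def by (auto, presburger)
    then show "scalars (h y) k = s k" by (simp add: scalars_def h_def d_def)
  qed
  define pt where "pt y = (\<lambda>i. if i \<in> K then Fin (y i) else Infty)" for y :: "nat \<Rightarrow> 'g"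
  have points: "points ({p} \<times> K) (h y) p = pt y" for y
    using hg by (auto simp: points_def pt_def g_def fun_eq_iff)
  have "definable M K {y \<in> K \<rightarrow>\<^sub>E UNIV. \<Phi> (scalars (h y)) (points ({p} \<times> K) (h y) p)}"
  proof (rule definable_of_env)
    show "env_definable M (\<lambda>e. \<Phi> (scalars e) (points ({p} \<times> K) e p))"
      using assms by (auto simp: config_definable_def)
    show "finite K" using K finite_subset by blast
    show "inj_on g K" by (rule inj)
    show "h y (g i) = y i" if "i \<in> K" for y i using that hg by blast
    show "h y j = d j" if "j \<notin> g ` K" for y j using that by (simp add: h_def)
  qed
  then have "definable M K {y \<in> K \<rightarrow>\<^sub>E UNIV. \<Phi> s (pt y)}" by (simp only: sc points)
  moreover have "fin_proj K ` part_at m K ?X = {y \<in> K \<rightarrow>\<^sub>E UNIV. \<Phi> s (pt y)}"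
  proof -
    have loc: "\<Phi> s x = \<Phi> s x'" if "\<And>i. i < m \<Longrightarrow> x i = x' i" for x x'
      by (rule config_local[OF assms, of "\<lambda>_. x" "\<lambda>_. x'" s]) (rule that)
    have "fin_proj K x \<in> K \<rightarrow>\<^sub>E UNIV \<and> \<Phi> s (pt (fin_proj K x))"
      if "x \<in> ?X" "{i. i < m \<and> x i \<noteq> Infty} = K" for x
    proof -
      have "pt (fin_proj K x) i = x i" if "i < m" for i
      proof -
        have "i \<in> K \<longleftrightarrow> x i \<noteq> Infty" using \<open>_ = K\<close> \<open>i < m\<close> by blast
        then show ?thesis by (cases "x i") (auto simp: pt_def fin_proj_def)
      qed
      then have "\<Phi> s (pt (fin_proj K x)) = \<Phi> s x" by (rule loc)
      then show ?thesis using that(1) by (simp add: fin_proj_def)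
    qed
    moreover have "y \<in> fin_proj K ` part_at m K ?X" if "y \<in> K \<rightarrow>\<^sub>E UNIV" "\<Phi> s (pt y)" for y
    proof -
      have "\<Phi> s (restrict (pt y) {..<m}) = \<Phi> s (pt y)" by (rule loc) simp
      then have "\<Phi> s (restrict (pt y) {..<m})" using that(2) by simp
      moreover have "fin_proj K (restrict (pt y) {..<m}) = y"
        using that(1) K by (auto simp: fin_proj_def pt_def fun_eq_iff PiE_def extensional_def)
      moreover have "{i. i < m \<and> restrict (pt y) {..<m} i \<noteq> Infty} = K"
        using K by (auto simp: pt_def)
      ultimately show ?thesis
        by (intro image_eqI[of _ _ "restrict (pt y) {..<m}"]) (simp_all add: part_at_def)
    qed
    ultimately show ?thesis unfolding part_at_def by (intro subset_antisym subsetI) auto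
  qed
  ultimately show "definable M K (fin_proj K ` part_at m K ?X)" by simp
qed

lemma definable_of_config_scalar:
  fixes M :: "('f, 'r, 'g::linordered_group_add) expansion"
  assumes "config_definable M m (\<lambda>E s. \<Phi> E s (s k))" and "\<And>E s a b. \<Phi> E (s(k := b)) a = \<Phi> E s a"
  shows "definable M {0} {y \<in> {0} \<rightarrow>\<^sub>E UNIV. \<Phi> E s (y 0)}"
proof -
  obtain L e where e: "points L e = E" "scalars e = s" using points_scalars_surj by blast
  have pt: "points L (e(2 * k := a)) = E" for a
    unfolding e(1)[symmetric] points_def fun_eq_iff by (auto, presburger)
  have sc: "scalars (e(2 * k := a)) = s(k := a)" for a
    unfolding e(2)[symmetric] by (auto simp: scalars_def fun_eq_iff)
  have "definable M {0} {y \<in> {0} \<rightarrow>\<^sub>E UNIV.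
      (\<lambda>e. \<Phi> (points L e) (scalars e) (scalars e k)) (e(2 * k := y 0))}"
    by (rule definable_of_env[where g="\<lambda>_. 2 * k" and d=e]) (use assms(1) in \<open>auto simp: config_definable_def\<close>)
  then show ?thesis by (simp only: pt sc assms(2) fun_upd_same)
qed

section \<open>Consequences of o-minimality\<close>

lemma interval_convex:
  "point_or_open_interval J \<Longrightarrow> y \<in> J \<Longrightarrow> z \<in> J \<Longrightarrow> y \<le> w \<Longrightarrow> w \<le> z \<Longrightarrow> w \<in> J"
  unfolding point_or_open_interval_def by (elim disjE exE) auto

text \<open>
  If \<open>g > 0\<close> cannot be halved, then \<open>g\<close> is the least positive element. In this discrete order \<open>a + a\<close> and
  \<open>a + a + g\<close> cannot both be doubles, so an interval of doubles is a point, and by o-minimality there are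
  only finitely many doubles. But \<open>(z + g) + (z + g)\<close> is larger than \<open>z + z\<close>.
\<close>

lemma o_minimal_halving:
  fixes M :: "('f, 'r, 'g::linordered_group_add) expansion"
  assumes "o_minimal M" and "0 < g"
  obtains r :: 'g where "0 < r" "r + r \<le> g"
proof -
  have "\<exists>r. 0 < r \<and> r + r \<le> g"
  proof (rule ccontr)
    assume "\<not> (\<exists>r. 0 < r \<and> r + r \<le> g)"
    then have no: "g < r + r" if "0 < r" for r
      using that not_le by blast
    have least: "g \<le> r" if "0 < r" for r
    proof (rule ccontr)
      assume r: "\<not> g \<le> r"
      define s where "s = - r + g"
      have rs: "r + s = g" by (simp add: s_def add.assoc[symmetric])
      have "0 < s" using r group_less_self_right[of r s] unfolding rs by (simp only: not_le)
      then have "g < min r s + min r s" using no[of "min r s"] \<open>0 < r\<close> by simp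
      also have "min r s + min r s \<le> r + s" by (intro group_add_mono) auto
      finally show False using rs by simp
    qed
    \<comment> \<open>\<open>a + g\<close> and \<open>g + a\<close> are both the immediate successor of \<open>a\<close>.\<close>
  have next_le: "a + g \<le> b" "g + a \<le> b" if "a < b" for a b
    proof -
      have "0 < - a + b" using group_less_left[of a 0 "- a + b"] that by (simp add: add.assoc[symmetric])
      then show "a + g \<le> b"
        using least[of "- a + b"] group_add_left_mono[of g "- a + b" a] by (simp add: add.assoc[symmetric])
      have "0 < b - a" using group_less_right[of 0 a "b - a"] that by simp
      then show "g + a \<le> b"
        using least[of "b - a"] group_add_right_mono[of g "b - a" a] by simp
    qed
    define D where "D = range (\<lambda>y::'g. y + y)"
    have D: "definable M {0} {x \<in> {0} \<rightarrow>\<^sub>E UNIV. \<exists>y. x 0 = y + y}"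
      unfolding definable_def
      by (rule exI[of _ "Ex 1 (Eq (Var 0) (Plus (Var 1) (Var 1)))"]) (simp add: override_on_def)
    have "(\<lambda>x. x 0) ` {x \<in> {0::nat} \<rightarrow>\<^sub>E UNIV. \<exists>y. x 0 = y + y} = D"
    proof -
      have "z \<in> (\<lambda>x. x 0) ` {x \<in> {0::nat} \<rightarrow>\<^sub>E UNIV. \<exists>y. x 0 = y + y}" if "z \<in> D" for z
        using that by (intro image_eqI[of _ _ "\<lambda>i\<in>{0}. z"]) (auto simp: D_def)
      then show ?thesis by (auto simp: D_def)
    qed
    then have "\<exists>F. finite F \<and> (\<forall>J\<in>F. point_or_open_interval J) \<and> D = \<Union>F"
      using assms(1)[unfolded o_minimal_def, rule_format, OF D] by simp
    then obtain F where F: "finite F" "\<forall>J\<in>F. point_or_open_interval J" "D = \<Union>F" by blast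
    have "y = z" if "J \<in> F" "y \<in> J" "z \<in> J" "y < z" for J y z
    proof -
      have "y + g \<le> z" using next_le that by blast
      then have "y + g \<in> J"
        using interval_convex[of J y z "y + g"] F(2) that assms(2) by (simp add: order_less_imp_le)
      then have "y + g \<in> D" "y \<in> D" using F(3) that by blast+
      then obtain a b where ab: "y = a + a" "y + g = b + b" by (auto simp: D_def)
      have "a < b"
      proof (rule ccontr)
        assume "\<not> a < b"
        then have "b + b \<le> a + a" by (intro group_add_mono) auto
        then show False using ab assms(2) by (metis group_less_self_right not_le)
      qed
      then have "a + g \<le> b" "g + a \<le> b" using next_le by auto
      have "a + a + g < a + a + g + g" using assms(2) by simp
      also have "\<dots> = a + (a + g) + g" by (simp add: add.assoc)
      also have "\<dots> \<le> a + (g + a) + g"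
        using next_le(1)[of a "g + a"] assms(2) by simp
      also have "\<dots> = (a + g) + (a + g)" by (simp add: add.assoc)
      also have "\<dots> \<le> b + b" using \<open>a + g \<le> b\<close> by (intro group_add_mono)
      finally show ?thesis using ab by simp
    qed
    then have "y = z" if "J \<in> F" "y \<in> J" "z \<in> J" for J y z
      using that by (metis linorder_less_linear)
    then have "finite J" if "J \<in> F" for J
      using that by (metis finite.emptyI finite.insertI finite_subset insertCI subsetI equals0I)
    then have fin: "finite D" using F by blast
    have "0 + 0 \<in> D" unfolding D_def by blast
    then have "Max D \<in> D" using fin by (intro Max_in) auto
    then obtain z where z: "Max D = z + z" by (auto simp: D_def)
    have "(z + g) + (z + g) \<le> Max D" using fin by (intro Max_ge) (auto simp: D_def)
    moreover have "z + z < (z + g) + (z + g)"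
      using assms(2) by (intro group_add_less_le) (simp_all add: order_less_imp_le)
    ultimately show False using z by simp
  qed
  then show thesis using that by blast
qed

text \<open>
  A weak form of the existence of suprema, which is all that the choice of thresholds needs. It
  suffices to find \<open>q\<close> in each of the finitely many intervals and to take the largest one.
\<close>

lemma o_minimal_half_bound:
  fixes M :: "('f, 'r, 'g::linordered_group_add) expansion" and P :: "'g \<Rightarrow> bool"
  assumes om: "o_minimal M" and "definable M {0} {y \<in> {0} \<rightarrow>\<^sub>E UNIV. P (y 0)}"
    and pos: "\<And>r. P r \<Longrightarrow> 0 < r \<and> r \<le> u" and "P r0"
  shows "\<exists>q. P q \<and> (\<forall>r. P r \<longrightarrow> r \<le> q + q)"
proof -
  have "(\<lambda>x. x 0) ` {y \<in> {0::nat} \<rightarrow>\<^sub>E UNIV. P (y 0)} = Collect P"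
  proof -
    have "z \<in> (\<lambda>x. x 0) ` {y \<in> {0::nat} \<rightarrow>\<^sub>E UNIV. P (y 0)}" if "P z" for z
      using that by (intro image_eqI[of _ _ "\<lambda>i\<in>{0}. z"]) auto
    then show ?thesis by auto
  qed
  then have "\<exists>F. finite F \<and> (\<forall>J\<in>F. point_or_open_interval J) \<and> Collect P = \<Union>F"
    using om[unfolded o_minimal_def, rule_format, OF assms(2)] by simp
  then obtain F where F: "finite F \<and> (\<forall>J\<in>F. point_or_open_interval J) \<and> Collect P = \<Union>F"
    by (rule exE)
  note F = F[THEN conjunct1] F[THEN conjunct2, THEN conjunct1] F[THEN conjunct2, THEN conjunct2]
  have u: "0 < u" using pos[OF \<open>P r0\<close>] by (metis less_le_trans)
  have P: "0 < r" "r \<le> u" if "r \<in> J" "J \<in> F" for r J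
    using that F(3) pos by blast+
  have J: "\<exists>q\<in>J. \<forall>r\<in>J. r \<le> q + q" if JF: "J \<in> F" and x: "x \<in> J" for J x
  proof -
    have x0: "0 < x" using P(1)[OF x JF] .
    consider (1) a where "J = {a}" | (2) a b where "J = {a<..<b}"
      | (3) a where "J = {..<a}" | (4) a where "J = {a<..}" | (5) "J = UNIV"
      using F(2)[rule_format, OF JF] unfolding point_or_open_interval_def by (elim disjE exE)
    then show ?thesis
    proof cases
      case 1
      then show ?thesis using x x0 by (auto intro: order_less_imp_le)
    next
      case 2
      obtain r where r: "0 < r" "r + r \<le> x" using o_minimal_halving[OF om x0] .
      have "r < x" using r by (metis group_less_self_right less_le_trans)
      have "b - x < b - r" "b - r < b"
        using \<open>r < x\<close> r(1) group_less_right[of "b - x" x "b - r"]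
        by (simp_all add: group_diff_less_iff) (metis add.assoc diff_add_cancel diff_conv_add_uminus group_less_left group_less_self_right)
      \<comment> \<open>Both \<open>b - r\<close> and \<open>x\<close> lie below \<open>b\<close>, and \<open>(b - r) + x > b\<close> because \<open>r < x\<close>.\<close>
      define q where "q = max (b - r) x"
      have "q \<in> J" using x 2 \<open>b - r < b\<close> by (auto simp: q_def less_max_iff_disj)
      moreover have "b \<le> q + q"
      proof -
        have "b = (b - x) + x" by simp
        also have "\<dots> \<le> q + q"
          using \<open>b - x < b - r\<close> by (intro group_add_mono) (auto simp: q_def le_max_iff_disj)
        finally show ?thesis .
      qed
      ultimately show ?thesis using 2 by (auto intro!: bexI[of _ q])
    next
      case 3
      then have "min x 0 \<in> J" using x by (auto simp: min_less_iff_disj)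
      then show ?thesis using P[OF _ JF] by fastforce
    next
      case 4
      then have "max x (u + u) \<in> J" using x by (auto simp: less_max_iff_disj)
      then have "u + u \<le> u" using P[OF _ JF] by fastforce
      then show ?thesis using u by (metis group_less_self_right not_le)
    next
      case 5
      then show ?thesis using P[of 0 J] JF by auto
    qed
  qed
  define F' where "F' = {J \<in> F. J \<noteq> {}}"
  have "\<forall>J\<in>F'. \<exists>q. q \<in> J \<and> (\<forall>r\<in>J. r \<le> q + q)" using J unfolding F'_def by blast
  then obtain Q where Q: "\<And>J. J \<in> F' \<Longrightarrow> Q J \<in> J \<and> (\<forall>r\<in>J. r \<le> Q J + Q J)" by metis
  have fin: "finite (Q ` F')" using F(1) by (simp add: F'_def)
  have ne: "Q ` F' \<noteq> {}" using \<open>P r0\<close> F(3) by (auto simp: F'_def)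
  show ?thesis
  proof (intro exI conjI allI impI)
    have "Max (Q ` F') \<in> Q ` F'" using fin ne by (rule Max_in)
    then obtain J where "J \<in> F'" "Max (Q ` F') = Q J" by blast
    then have "Max (Q ` F') \<in> \<Union>F" using Q[of J] by (auto simp: F'_def)
    then show "P (Max (Q ` F'))" using F(3) by auto
  next
    fix r assume "P r"
    then obtain J where "J \<in> F'" "r \<in> J" using F(3) by (auto simp: F'_def)
    then have "r \<le> Q J + Q J" "Q J \<le> Max (Q ` F')" using Q fin by auto
    then show "r \<le> Max (Q ` F') + Max (Q ` F')" by (meson group_add_mono order_trans)
  qed
qed

section \<open>Basic neighbourhoods\<close>

lemma near_sym: "near r x y \<longleftrightarrow> near r y x"
  by (auto simp: near_def split: with_infty.splits)

lemma near_mono: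
  fixes r s :: "'g::linordered_group_add"
  assumes "near r x y" "r \<le> s"
  shows "near s x y"
proof -
  obtain a b where ab: "x = Fin a" "y = Fin b" "a < b + r" "b < a + r"
    using assms(1) by (auto simp: near_def split: with_infty.splits)
  have "b + r \<le> b + s" "a + r \<le> a + s" using assms(2) by simp_all
  then have "a < b + s" "b < a + s" using ab(3,4) by (blast intro: less_le_trans)+
  then show ?thesis using ab by simp
qed

lemma near_triangle:
  fixes r s q :: "'g::linordered_group_add"
  assumes "near r x y" "near s y z" "r \<le> q" "s \<le> q"
  shows "near (q + q) x z"
proof -
  have "near q x y" "near q y z" using assms near_mono by blast+
  then obtain a b c where abc: "x = Fin a" "y = Fin b" "z = Fin c"
    "a < b + q" "b < a + q" "b < c + q" "c < b + q"
    by (auto simp: near_def split: with_infty.splits)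
  have "b + q < c + q + q" "b + q < a + q + q"
    using abc by simp_all
  then have "a < c + q + q" "c < a + q + q"
    using abc by (blast intro: less_trans)+
  then show ?thesis using abc by (simp add: add.assoc)
qed

definition basic :: "'g::linordered_group_add with_infty \<Rightarrow> 'g \<Rightarrow> 'g \<Rightarrow> 'g with_infty set" where
  "basic x r t = {y. if x = Infty then Fin t < y else near r x y}"

lemma basic_mono:
  fixes r :: "'g::linordered_group_add"
  assumes "r \<le> r'" "t' \<le> t"
  shows "basic x r t \<subseteq> basic x r' t'"
proof
  fix y assume y: "y \<in> basic x r t"
  show "y \<in> basic x r' t'"
  proof (cases "x = Infty")
    case True
    have "Fin t' \<le> Fin t" using assms(2) by simp
    then have "Fin t' < y" using True y le_less_trans[of "Fin t'" "Fin t" y] by (simp add: basic_def)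
    then show ?thesis using True by (simp add: basic_def)
  next
    case False
    then show ?thesis using y near_mono[OF _ assms(1)] by (simp add: basic_def)
  qed
qed

lemma basic_self: "0 < r \<Longrightarrow> x \<in> basic x r t"
  by (cases x) (auto simp: basic_def)

lemma basic_eq_interval:
  "basic x r t = (case x of Infty \<Rightarrow> {Fin t<..} | Fin a \<Rightarrow> {Fin (a - r)<..<Fin (a + r)})"
proof (cases x)
  case (Fin a)
  have "y \<in> basic x r t \<longleftrightarrow> y \<in> {Fin (a - r)<..<Fin (a + r)}" for y
    by (cases y) (auto simp: Fin basic_def group_diff_less_iff)
  then have "basic x r t = {Fin (a - r)<..<Fin (a + r)}" by (rule set_eqI)
  then show ?thesis by (simp only: Fin with_infty.case)
next
  case Infty
  then show ?thesis by (simp add: basic_def greaterThan_def)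
qed

lemma openin_basic: "openin top_inf (basic x r t)"
  unfolding basic_eq_interval top_inf_def
  by (cases x) (auto intro!: topology_generated_by_Basis)

lemma topspace_top_inf [simp]: "topspace top_inf = UNIV"
  unfolding top_inf_def topology_generated_by_topspace by auto

lemma topspace_top_inf_power [simp]: "topspace (top_inf_power m) = {..<m} \<rightarrow>\<^sub>E UNIV"
  by (simp add: top_inf_power_def)

text \<open>
  The positive element \<open>g\<close> supplies a radius where the open set does not restrict it; in the trivial group
  there are no radii at all.
\<close>

lemma basic_in_open:
  fixes g :: "'g::linordered_group_add"
  assumes g: "0 < g" and "openin top_inf W" and "x \<in> W"
  shows "\<exists>r>0. \<exists>t. basic (x :: 'g with_infty) r t \<subseteq> W"
proof -
  have "generate_topology_on (insert UNIV (range (\<lambda>a. {..<Fin a}) \<union>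
      {{Fin a<..<Fin b} |a b. True} \<union> range (\<lambda>b. {Fin b<..}))) W"
    using assms(2) by (simp add: top_inf_def openin_topology_generated_by_iff)
  then show ?thesis using \<open>x \<in> W\<close>
  proof (induction)
    case Empty
    then show ?case by simp
  next
    case (Int V W)
    then obtain r t r' t' where *: "0 < r" "basic x r t \<subseteq> V" "0 < r'" "basic x r' t' \<subseteq> W"
      by blast
    have "basic x (min r r') (max t t') \<subseteq> V \<inter> W"
      using *(2,4) basic_mono[of "min r r'" r t "max t t'" x] basic_mono[of "min r r'" r' t' "max t t'" x]
      by auto
    moreover have "0 < min r r'" using * by simp
    ultimately show ?case by blast
  next
    case (UN K)
    then obtain V where "V \<in> K" "x \<in> V" by blast
    then obtain r t where "0 < r" "basic x r t \<subseteq> V" using UN by blast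
    then show ?case using \<open>V \<in> K\<close> by blast
  next
    case (Basis V)
    have lower: "\<exists>r>0. \<forall>y. near r x y \<longrightarrow> Fin c < y" if lt: "Fin c < x" "x \<noteq> Infty" for c
    proof -
      obtain a where a: "x = Fin a" "c < a" using lt by (cases x) simp_all
      have "c < y" if "a < y + (- c + a)" for y
        using that group_less_right[of c "- c + a" y] by (simp add: add.assoc[symmetric])
      moreover have "0 < - c + a"
        using a group_less_left[of c 0 "- c + a"] by (simp add: add.assoc[symmetric])
      ultimately show ?thesis
        using a by (intro exI[of _ "- c + a"]) (auto simp: near_def split: with_infty.splits)
    qed
    have upper: "\<exists>r>0. \<forall>y. near r x y \<longrightarrow> y < Fin c" if lt: "x < Fin c" for c
    proof -
      obtain a where a: "x = Fin a" "a < c" using lt by (cases x) auto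
      have "0 < - a + c"
        using a group_less_left[of a 0 "- a + c"] by (simp add: add.assoc[symmetric])
      moreover have "a + (- a + c) = c" by (simp add: add.assoc[symmetric])
      ultimately show ?thesis
        using a by (intro exI[of _ "- a + c"]) (auto simp: near_def split: with_infty.splits)
    qed
    consider "V = UNIV" | a where "V = {..<Fin a}" | a b where "V = {Fin a<..<Fin b}"
      | b where "V = {Fin b<..}" using Basis by blast
    then show ?case
    proof cases
      case 1
      then show ?thesis using g by blast
    next
      case (2 a)
      then have "x < Fin a" using Basis by simp
      moreover from this have "x \<noteq> Infty" by auto
      ultimately show ?thesis using upper[of a] 2 by (auto simp: basic_def subset_eq)
    next
      case (3 a b)
      then have *: "x < Fin b" "Fin a < x" using Basis by auto
      then have "x \<noteq> Infty" by auto
      obtain r where r: "0 < r" "\<forall>y. near r x y \<longrightarrow> y < Fin b" using upper * by blast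
      obtain r' where r': "0 < r'" "\<forall>y. near r' x y \<longrightarrow> Fin a < y"
        using lower * \<open>x \<noteq> Infty\<close> by blast
      have "near r x y \<and> near r' x y" if "near (min r r') x y" for y
        using near_mono[OF that, of r] near_mono[OF that, of r'] by simp
      then have "basic x (min r r') t \<subseteq> V" for t
        using 3 r r' \<open>x \<noteq> Infty\<close> by (auto simp: basic_def)
      moreover have "0 < min r r'" using r r' by simp
      ultimately show ?thesis by blast
    next
      case (4 b)
      show ?thesis
      proof (cases "x = Infty")
        case True
        then show ?thesis using 4 g by (auto simp: basic_def)
      next
        case False
        then show ?thesis using lower[of b] 4 Basis by (auto simp: basic_def subset_eq)
      qed
    qed
  qed
qed

definition nbhd :: "nat \<Rightarrow> 'g::linordered_group_add point \<Rightarrow> 'g \<Rightarrow> 'g \<Rightarrow> 'g point set" where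
  "nbhd m a r t = {x. \<forall>i<m. x i \<in> basic (a i) r t}"

lemma nbhd_mono: "r \<le> r' \<Longrightarrow> t' \<le> t \<Longrightarrow> nbhd m a r t \<subseteq> nbhd m a r' t'"
  unfolding nbhd_def using basic_mono[of r r' t' t] by blast

lemma nbhd_self: "0 < r \<Longrightarrow> a \<in> nbhd m a r t"
  by (simp add: nbhd_def basic_self)

lemma openin_nbhd: "openin (top_inf_power m) (nbhd m a r t \<inter> ({..<m} \<rightarrow>\<^sub>E UNIV))"
proof -
  have "nbhd m a r t \<inter> ({..<m} \<rightarrow>\<^sub>E UNIV) = (\<Pi>\<^sub>E i\<in>{..<m}. basic (a i) r t)"
    by (auto simp: nbhd_def PiE_def Pi_def)
  then show ?thesis
    by (simp add: top_inf_power_def openin_PiE openin_basic)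
qed

text \<open>
  Finitely many conditions that persist when the neighbourhood shrinks can be met simultaneously.
\<close>

lemma uniform_radius:
  fixes g :: "'g::linordered_group_add" and P :: "'i \<Rightarrow> 'g \<Rightarrow> 'g \<Rightarrow> bool"
  assumes "finite S" "0 < g" and "\<And>i. i \<in> S \<Longrightarrow> \<exists>r>0. \<exists>t. P i r t"
    and "\<And>i r r' t t'. P i r t \<Longrightarrow> r' \<le> r \<Longrightarrow> t \<le> t' \<Longrightarrow> P i r' t'"
  shows "\<exists>r>0. \<exists>t. \<forall>i\<in>S. P i r t"
  using assms(1,3)
proof (induction S)
  case empty
  then show ?case using assms(2) by auto
next
  case (insert i S)
  have "\<exists>r>0. \<exists>t. \<forall>i\<in>S. P i r t" by (rule insert.IH) (simp add: insert.prems)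
  then obtain r t where 1: "0 < r" "\<forall>i\<in>S. P i r t" by (elim exE conjE)
  have "\<exists>r>0. \<exists>t. P i r t" by (rule insert.prems) simp
  then obtain r' t' where 2: "0 < r'" "P i r' t'" by (elim exE conjE)
  note * = 1 2
  have "\<forall>j\<in>insert i S. P j (min r r') (max t t')"
  proof
    fix j assume "j \<in> insert i S"
    then consider "j = i" | "j \<in> S" by blast
    then show "P j (min r r') (max t t')"
    proof cases
      case 1
      show ?thesis unfolding 1 by (rule assms(4)[OF *(4)]) simp_all
    next
      case 2
      show ?thesis by (rule assms(4)[OF *(2)[rule_format, OF 2]]) simp_all
    qed
  qed
  moreover have "0 < min r r'" using * by simp
  ultimately show ?case by blast
qed

lemma nbhd_in_open:
  fixes g :: "'g::linordered_group_add"
  assumes "0 < g" "openin (top_inf_power m) U" "x \<in> U"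
  shows "\<exists>r>0. \<exists>t. nbhd m (x :: 'g point) r t \<inter> ({..<m} \<rightarrow>\<^sub>E UNIV) \<subseteq> U"
proof -
  obtain V where V: "x \<in> (\<Pi>\<^sub>E i\<in>{..<m}. V i)" "\<And>i. openin top_inf (V i)" "(\<Pi>\<^sub>E i\<in>{..<m}. V i) \<subseteq> U"
    using product_topology_open_contains_basis[OF assms(2)[unfolded top_inf_power_def] assms(3)] by blast
  have "\<exists>r>0. \<exists>t. \<forall>i\<in>{..<m}. basic (x i) r t \<subseteq> V i"
  proof (rule uniform_radius[OF _ assms(1)])
    show "\<exists>r>0. \<exists>t. basic (x i) r t \<subseteq> V i" if "i \<in> {..<m}" for i
      by (rule basic_in_open[OF assms(1) V(2)]) (use V(1) that in \<open>rule PiE_mem\<close>)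
    show "basic (x i) r' t' \<subseteq> V i" if "basic (x i) r t \<subseteq> V i" "r' \<le> r" "t \<le> t'" for i r r' t t'
      using that basic_mono[of r' r t t' "x i"] by blast
  qed simp
  then obtain r t where "0 < r" "\<forall>i\<in>{..<m}. basic (x i) r t \<subseteq> V i" by blast
  then have "nbhd m x r t \<inter> ({..<m} \<rightarrow>\<^sub>E UNIV) \<subseteq> U"
    using V(3) by (fastforce simp: nbhd_def PiE_def Pi_def subset_eq)
  then show ?thesis using \<open>0 < r\<close> by blast
qed

lemma openin_iff_nbhd:
  fixes g :: "'g::linordered_group_add"
  assumes "0 < g"
  shows "openin (top_inf_power m) U \<longleftrightarrow> U \<subseteq> {..<m} \<rightarrow>\<^sub>E UNIV \<and>
    (\<forall>x\<in>U. \<exists>r>0. \<exists>t. nbhd m (x :: 'g point) r t \<inter> ({..<m} \<rightarrow>\<^sub>E UNIV) \<subseteq> U)"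
    (is "_ \<longleftrightarrow> ?r")
proof
  assume "openin (top_inf_power m) U"
  then show ?r using nbhd_in_open[OF assms, of m U] openin_subset[of "top_inf_power m" U] by auto
next
  assume *: ?r
  show "openin (top_inf_power m) U"
  proof (subst openin_subopen, intro ballI)
    fix x assume "x \<in> U"
    then obtain r t where "0 < r" "nbhd m x r t \<inter> ({..<m} \<rightarrow>\<^sub>E UNIV) \<subseteq> U" using * by blast
    moreover have "x \<in> nbhd m x r t \<inter> ({..<m} \<rightarrow>\<^sub>E UNIV)"
      using nbhd_self[OF \<open>0 < r\<close>, of x m t] * \<open>x \<in> U\<close> by blast
    ultimately show "\<exists>T. openin (top_inf_power m) T \<and> x \<in> T \<and> T \<subseteq> U"
      by (intro exI[of _ "nbhd m x r t \<inter> ({..<m} \<rightarrow>\<^sub>E UNIV)"] conjI openin_nbhd)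
  qed
qed

section \<open>Separating closed sets\<close>

lemma project_simps [simp]: "project J a i = (if i \<in> J then a i else Infty)"
  by (simp add: project_def)

lemma project_project: "project J (project K a) = project (J \<inter> K) a"
  by (auto simp: project_def fun_eq_iff)

definition avoids :: "nat \<Rightarrow> 'g::linordered_group_add point set \<Rightarrow> 'g point \<Rightarrow> 'g \<Rightarrow> 'g \<Rightarrow> bool" where
  "avoids m X a r t \<longleftrightarrow> (\<forall>x\<in>X. x \<notin> nbhd m a r t)"

text \<open>
  The bound \<open>u\<close> is one fixed positive element: it limits how far a coordinate can move inside a
  neighbourhood of radius \<open>r\<close>, also in those that tend to infinity.
\<close>

definition sep_radius :: "nat \<Rightarrow> nat set \<Rightarrow> 'g point set \<Rightarrow> 'g point set \<Rightarrow> 'g \<Rightarrow> 'g \<Rightarrow>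
    'g::linordered_group_add point \<Rightarrow> bool" where
  "sep_radius m L A B u r a \<longleftrightarrow> 0 < r \<and> r \<le> u \<and>
     (\<forall>J\<in>{J. L \<subseteq> J \<and> J \<subseteq> {..<m}}. \<exists>t. avoids m A (project J a) r t \<or> avoids m B (project J a) r t)"

text \<open>
  One threshold has to serve all radii \<open>s\<close>, not only the radius of a given neighbourhood of \<open>a\<close>: the
  radius of a neighbourhood may be tiny although a much larger one, coming from a nearby point of \<open>B\<close>, is
  separating at \<open>a\<close> as well.
\<close>

definition threshold :: "nat \<Rightarrow> nat set \<Rightarrow> 'g point set \<Rightarrow> 'g point set \<Rightarrow> 'g \<Rightarrow>
    'g::linordered_group_add point \<Rightarrow> 'g \<Rightarrow> bool" where
  "threshold m L A B u a t \<longleftrightarrow> (\<forall>s. 0 < s \<and> sep_radius m L A B u (s + s) a \<longrightarrow> avoids m B a s t)"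

text \<open>
  Three doublings: the radii of two meeting neighbourhoods add up, a separating radius halves on the way
  from one centre to the other, and thresholds are demanded only up to half a separating radius.
\<close>

abbreviation eightfold :: "'g::plus \<Rightarrow> 'g" where
  "eightfold r \<equiv> r + r + (r + r) + (r + r + (r + r))"

text \<open>
  The summand \<open>u\<close> absorbs the movement of finite coordinates; the bound on the finite coordinates of
  \<open>a\<close> serves the case of incomparable sets of finite coordinates. All admissible radii and thresholds are
  used at once, which avoids definable choice.
\<close>

definition tube :: "nat \<Rightarrow> nat set \<Rightarrow> 'g point set \<Rightarrow> 'g point set \<Rightarrow> 'g \<Rightarrow>
    'g::linordered_group_add point set" where
  "tube m L A B u = {x. \<exists>a\<in>A. \<exists>r t. 0 < r \<and>
     sep_radius m L A B u (eightfold r) a \<and>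
     threshold m L A B u a t \<and> (\<forall>i\<in>{..<m}. a i = Infty \<or> \<not> Fin t < a i) \<and> x \<in> nbhd m a r (t + u)}"

lemma avoids_mono: "avoids m X a r t \<Longrightarrow> r' \<le> r \<Longrightarrow> t \<le> t' \<Longrightarrow> avoids m X a r' t'"
  unfolding avoids_def using nbhd_mono[of r' r t t' m a] by blast

lemma sep_radius_bounds:
  assumes "sep_radius m L A B u r a"
  shows "0 < r" "r \<le> u"
  using assms unfolding sep_radius_def by (blast intro: conjunct1)+

lemma sep_radius_avoids:
  assumes "sep_radius m L A B u r a" "L \<subseteq> J" "J \<subseteq> {..<m}"
  obtains t where "avoids m A (project J a) r t \<or> avoids m B (project J a) r t"
proof -
  have "J \<in> {J. L \<subseteq> J \<and> J \<subseteq> {..<m}}" using assms by simp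
  then have "\<exists>t. avoids m A (project J a) r t \<or> avoids m B (project J a) r t"
    using assms(1) unfolding sep_radius_def by (elim conjE) (rule bspec)
  then show thesis by (elim exE) (rule that)
qed

lemma sep_radiusI:
  assumes "0 < r" "r \<le> u"
    and "\<And>J. L \<subseteq> J \<Longrightarrow> J \<subseteq> {..<m} \<Longrightarrow>
      \<exists>t. avoids m A (project J a) r t \<or> avoids m B (project J a) r t"
  shows "sep_radius m L A B u r a"
  unfolding sep_radius_def using assms by simp

lemma sep_radius_sym: "sep_radius m L A B u r a \<longleftrightarrow> sep_radius m L B A u r a"
  unfolding sep_radius_def by (simp add: disj_commute)

lemma sep_radius_mono:
  assumes "sep_radius m L A B u r a" "0 < s" "s \<le> r"
  shows "sep_radius m L A B u s a"
proof (rule sep_radiusI)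
  show "0 < s" by fact
  show "s \<le> u" using assms(3) sep_radius_bounds(2)[OF assms(1)] by (rule order_trans)
  fix J assume "L \<subseteq> J" "J \<subseteq> {..<m}"
  then obtain t where "avoids m A (project J a) r t \<or> avoids m B (project J a) r t"
    by (rule sep_radius_avoids[OF assms(1)])
  then have "avoids m A (project J a) s t \<or> avoids m B (project J a) s t"
    using avoids_mono[OF _ assms(3) order_refl, of m _ "project J a" t] by blast
  then show "\<exists>t. avoids m A (project J a) s t \<or> avoids m B (project J a) s t" by (rule exI)
qed

lemma sep_radius_project:
  assumes "sep_radius m L A B u r b" "L \<subseteq> K" "K \<subseteq> {..<m}"
  shows "sep_radius m L A B u r (project K b)"
proof (rule sep_radiusI)
  show "0 < r" "r \<le> u" using sep_radius_bounds[OF assms(1)] .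
  fix J assume "L \<subseteq> J" "J \<subseteq> {..<m}"
  then have "L \<subseteq> J \<inter> K" "J \<inter> K \<subseteq> {..<m}" using assms by blast+
  then obtain t where "avoids m A (project (J \<inter> K) b) r t \<or> avoids m B (project (J \<inter> K) b) r t"
    by (rule sep_radius_avoids[OF assms(1)])
  then show "\<exists>t. avoids m A (project J (project K b)) r t \<or> avoids m B (project J (project K b)) r t"
    unfolding project_project by (rule exI)
qed

text \<open>
  A point close to \<open>\<pi>\<^sub>J a\<close> is close to \<open>\<pi>\<^sub>J c\<close>, by the triangle inequality.
\<close>

lemma sep_radius_near:
  fixes r :: "'g::linordered_group_add"
  assumes "sep_radius m L A B u (r + r) c" "0 < r"
    and near: "\<And>i. i < m \<Longrightarrow> a i = Infty \<and> c i = Infty \<or> near r (c i) (a i)"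
  shows "sep_radius m L A B u r a"
proof (rule sep_radiusI)
  show "0 < r" by fact
  have "r \<le> r + r" using assms(2) by (simp add: order_less_imp_le)
  then show "r \<le> u" using sep_radius_bounds(2)[OF assms(1)] by (rule order_trans)
  fix J assume "L \<subseteq> J" "J \<subseteq> {..<m}"
  then obtain t where t: "avoids m A (project J c) (r + r) t \<or> avoids m B (project J c) (r + r) t"
    by (rule sep_radius_avoids[OF assms(1)])
  have "basic (project J a i) r t \<subseteq> basic (project J c i) (r + r) t" if "i < m" for i
    using near[OF that] near_triangle[of r "c i" "a i" r _ r] by (auto simp: basic_def)
  then have sub: "nbhd m (project J a) r t \<subseteq> nbhd m (project J c) (r + r) t"
    unfolding nbhd_def by blast
  then have "avoids m X (project J a) r t" if "avoids m X (project J c) (r + r) t" for X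
    using that unfolding avoids_def by blast
  then have "avoids m A (project J a) r t \<or> avoids m B (project J a) r t" using t by blast
  then show "\<exists>t. avoids m A (project J a) r t \<or> avoids m B (project J a) r t" by (rule exI)
qed

lemma avoids_local:
  assumes "\<And>i. i < m \<Longrightarrow> a i = a' i"
  shows "avoids m X a r t = avoids m X a' r t"
  using assms unfolding avoids_def nbhd_def by auto

text \<open>
  Let \<open>K\<close> be the set of finite coordinates of \<open>a\<close>, let \<open>r\<close> be the larger radius and \<open>s = 2r\<close>.
  On \<open>K\<close> the points \<open>a\<close> and \<open>b\<close> are within \<open>s\<close> of each other, via \<open>x\<close>. Thus \<open>2s\<close> is separating at
  \<open>a\<close>: this is immediate if \<open>r\<close> belongs to \<open>a\<close>, and otherwise \<open>4s = 8r\<close> is separating at \<open>b\<close>, hence at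
  \<open>\<pi>\<^sub>K b\<close>, from where one moves to \<open>a\<close> at the cost of a factor of two. So \<open>N(a, s, ta)\<close> misses \<open>B\<close>.
  It contains \<open>b\<close>, however, since off \<open>K\<close> the coordinates of \<open>x\<close> exceed \<open>ta + u\<close> and those of \<open>b\<close> are
  at most \<open>u\<close> smaller.
\<close>

lemma tubes_meet_aux:
  fixes u :: "'g::linordered_group_add"
  assumes "a \<in> A" "b \<in> B" "0 < ra" "0 < rb"
    and ga: "sep_radius m L A B u (eightfold ra) a"
    and gb: "sep_radius m L A B u (eightfold rb) b"
    and ta: "threshold m L A B u a ta"
    and xa: "x \<in> nbhd m a ra (ta + u)" and xb: "x \<in> nbhd m b rb tb"
    and L: "L \<subseteq> {..<m}" "\<And>i. i \<in> L \<Longrightarrow> a i \<noteq> Infty"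
    and fin: "\<And>i. i < m \<Longrightarrow> b i = Infty \<Longrightarrow> a i = Infty"
  shows False
proof -
  define K where "K = {i. i < m \<and> a i \<noteq> Infty}"
  define r where "r = max ra rb"
  define s where "s = r + r"
  have r: "0 < r" "ra \<le> r" "rb \<le> r" using assms(3) by (auto simp: r_def less_max_iff_disj)
  have s: "0 < s" using r by (simp add: s_def)
  have ab: "near s (a i) (b i)" if "i \<in> K" for i
  proof -
    have i: "i < m" "a i \<noteq> Infty" using that by (auto simp: K_def)
    then have bi: "b i \<noteq> Infty" using fin by blast
    have "near ra (a i) (x i)" using i xa by (simp add: nbhd_def basic_def)
    moreover have "near rb (x i) (b i)"
      using i(1) bi xb near_sym[of rb "x i" "b i"] by (simp add: nbhd_def basic_def)
    ultimately show ?thesis unfolding s_def using r by (intro near_triangle)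
  qed
  have le2: "p \<le> p + p" if "0 < p" for p :: 'g using that by (simp add: order_less_imp_le)
  have g: "sep_radius m L A B u (s + s) a"
  proof (cases "rb \<le> ra")
    case True
    then have "s = ra + ra" by (simp add: s_def r_def)
    then show ?thesis using ga s le2[of "s + s"] by (intro sep_radius_mono[OF ga]) simp_all
  next
    case False
    then have srb: "s = rb + rb" by (simp add: s_def r_def)
    show ?thesis
    proof (rule sep_radius_near)
      show "sep_radius m L A B u (s + s + (s + s)) (project K b)"
        using gb L unfolding srb by (intro sep_radius_project) (auto simp: K_def)
      show "0 < s + s" using s by simp
      show "a i = Infty \<and> project K b i = Infty \<or> near (s + s) (project K b i) (a i)" if "i < m" for i
        using ab[of i] near_mono[of s "a i" "b i" "s + s"] le2[OF s] that
        by (auto simp: K_def near_sym[of "s + s" "b i"])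
    qed
  qed
  have "rb \<le> u"
  proof -
    have "rb \<le> rb + rb" "rb + rb \<le> rb + rb + (rb + rb)"
      "rb + rb + (rb + rb) \<le> eightfold rb"
      using assms(4) by (simp_all add: le2)
    then show ?thesis using sep_radius_bounds(2)[OF gb] by (meson order_trans)
  qed
  have "b \<in> nbhd m a s ta"
    unfolding nbhd_def
  proof (intro CollectI allI impI)
    fix i assume i: "i < m"
    show "b i \<in> basic (a i) s ta"
    proof (cases "a i = Infty")
      case False
      then show ?thesis using ab[of i] i by (simp add: basic_def K_def)
    next
      case True
      show ?thesis
      proof (cases "b i")
        case (Fin \<beta>)
        then obtain \<xi> where "x i = Fin \<xi>" "\<xi> < \<beta> + rb"
          using xb i by (cases "x i") (auto simp: nbhd_def basic_def)
        moreover from this have "ta + u < \<xi>" using xa i True by (auto simp: nbhd_def basic_def)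
        moreover have "\<beta> + rb \<le> \<beta> + u" using \<open>rb \<le> u\<close> by simp
        ultimately have "ta + u < \<beta> + u" by (meson less_le_trans less_trans)
        then show ?thesis using True Fin by (simp add: basic_def)
      qed (use True in \<open>simp add: basic_def\<close>)
    qed
  qed
  moreover have "avoids m B a s ta" using ta g s unfolding threshold_def by blast
  ultimately show False using assms(2) unfolding avoids_def by blast
qed

text \<open>
  If the finite coordinates of \<open>a\<close> and \<open>b\<close> are nested, \<open>tubes_meet_aux\<close> applies, possibly with the
  roles exchanged. Otherwise some \<open>i\<close> is finite in \<open>a\<close> only and some \<open>j\<close> in \<open>b\<close> only, and a
  common point \<open>x\<close> gives the cycle \<open>x i < ta + u < x j < tb + u < x i\<close>.
\<close>

lemma tubes_disjoint:
  fixes u :: "'g::linordered_group_add"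
  assumes L: "L \<subseteq> {..<m}" "\<And>x i. x \<in> A \<union> B \<Longrightarrow> i \<in> L \<Longrightarrow> x i \<noteq> Infty"
  shows "tube m L A B u \<inter> tube m L B A u = {}"
proof (rule ccontr)
  assume "tube m L A B u \<inter> tube m L B A u \<noteq> {}"
  then obtain x a ra ta b rb tb where a: "a \<in> A" "0 < ra"
    "sep_radius m L A B u (eightfold ra) a" "threshold m L A B u a ta"
    "\<forall>i\<in>{..<m}. a i = Infty \<or> \<not> Fin ta < a i" "x \<in> nbhd m a ra (ta + u)"
    and b: "b \<in> B" "0 < rb"
    "sep_radius m L B A u (eightfold rb) b" "threshold m L B A u b tb"
    "\<forall>i\<in>{..<m}. b i = Infty \<or> \<not> Fin tb < b i" "x \<in> nbhd m b rb (tb + u)"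
    unfolding tube_def by blast
  have ba: "sep_radius m L B A u (eightfold ra) a"
    "sep_radius m L A B u (eightfold rb) b"
    using a(3) b(3) sep_radius_sym by blast+
  have below: "y < Fin (t + u)"
    if h: "sep_radius m L A' B' u (eightfold r) c" "0 < r"
      "z \<noteq> Infty" "\<not> Fin t < z" "y \<in> basic z r t'"
    for y z c r t t' A' B'
  proof -
    have "r \<le> r + r" "r + r \<le> r + r + (r + r)"
      "r + r + (r + r) \<le> eightfold r"
      using h(2) by (simp_all add: order_less_imp_le)
    then have "r \<le> u" using sep_radius_bounds(2)[OF h(1)] by (meson order_trans)
    obtain \<gamma> \<eta> where yz: "z = Fin \<gamma>" "y = Fin \<eta>" "\<eta> < \<gamma> + r"
      using h(3,5) by (cases z; cases y) (simp_all add: basic_def)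
    then have "\<gamma> + r \<le> t + u"
      using h(4) \<open>r \<le> u\<close> by (intro group_add_mono) auto
    then show ?thesis using yz by simp
  qed
  have above: "Fin t < y" if "y \<in> basic z r t" "z = Infty" for y z and r t :: 'g
    using that by (simp add: basic_def)
  have basic: "x i \<in> basic (a i) ra (ta + u)" "x i \<in> basic (b i) rb (tb + u)" if "i < m" for i
    using a(6) b(6) that by (auto simp: nbhd_def)
  show False
  proof (cases "\<forall>i<m. b i = Infty \<longrightarrow> a i = Infty")
    case True
    show False
      by (rule tubes_meet_aux[OF a(1) b(1) a(2) b(2) a(3) ba(2) a(4) a(6) b(6) L(1)])
        (use L(2) a(1) True in auto)
  next
    case False
    show False
    proof (cases "\<forall>i<m. a i = Infty \<longrightarrow> b i = Infty")
      case True
      show False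
        by (rule tubes_meet_aux[OF b(1) a(1) b(2) a(2) b(3) ba(1) b(4) b(6) a(6) L(1)])
          (use L(2) b(1) True in auto)
    next
      case neg: False
      obtain i where i: "i < m" "b i = Infty" "a i \<noteq> Infty" using False by blast
      obtain j where j: "j < m" "a j = Infty" "b j \<noteq> Infty" using neg by blast
      have "\<not> Fin ta < a i" "\<not> Fin tb < b j" using a(5) b(5) i j by auto
      then have "x i < Fin (ta + u)" "x j < Fin (tb + u)"
        using below[OF a(3) a(2) i(3) _ basic(1)[OF i(1)]] below[OF b(3) b(2) j(3) _ basic(2)[OF j(1)]]
        by blast+
      moreover have "Fin (ta + u) < x j" by (rule above[OF basic(1)[OF j(1)] j(2)])
      moreover have "Fin (tb + u) < x i" by (rule above[OF basic(2)[OF i(1)] i(2)])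
      ultimately show False by (meson less_asym less_trans)
    qed
  qed
qed

lemma openin_tube: "openin (top_inf_power m) (tube m L A B u \<inter> ({..<m} \<rightarrow>\<^sub>E UNIV))"
proof -
  let ?N = "{nbhd m a r (t + u) \<inter> ({..<m} \<rightarrow>\<^sub>E UNIV) |a r t. a \<in> A \<and> 0 < r \<and>
     sep_radius m L A B u (eightfold r) a \<and>
     threshold m L A B u a t \<and> (\<forall>i\<in>{..<m}. a i = Infty \<or> \<not> Fin t < a i)}"
  have "tube m L A B u \<inter> ({..<m} \<rightarrow>\<^sub>E UNIV) = \<Union>?N"
    unfolding tube_def by blast
  moreover have "openin (top_inf_power m) (\<Union>?N)"
    by (rule openin_Union) (use openin_nbhd in blast)
  ultimately show ?thesis by simp
qed

lemma config_nbhd: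
  assumes "group_term \<tau>" "group_term \<sigma>"
  shows "config_definable M m (\<lambda>E s. E q \<in> nbhd m (E p) (\<tau> s) (\<sigma> s))"
proof -
  have "config_definable M m (\<lambda>E s. \<forall>i\<in>{..<m}. (E p i = Infty \<and> Fin (\<sigma> s) < E q i) \<or>
      near (\<tau> s) (E p i) (E q i))"
    by (intro config_finite_all config_disj config_conj config_infinite config_term_less_coordinate config_near assms) auto
  moreover have "(\<forall>i\<in>{..<m}. (E p i = Infty \<and> Fin (\<sigma> s) < E q i) \<or> near (\<tau> s) (E p i) (E q i)) \<longleftrightarrow>
      E q \<in> nbhd m (E p) (\<tau> s) (\<sigma> s)" for E s
    by (auto simp: nbhd_def basic_def)
  ultimately show ?thesis by (simp only:)
qed

lemma config_avoids:
  assumes X: "definable_inf M m X" and "group_term \<tau>" "group_term \<sigma>"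
  shows "config_definable M m (\<lambda>E s. avoids m X (E p) (\<tau> s) (\<sigma> s))"
proof -
  have sub: "X \<subseteq> {..<m} \<rightarrow>\<^sub>E UNIV" using X by (simp add: definable_inf_def)
  have "avoids m X a r t \<longleftrightarrow> (\<forall>y. restrict y {..<m} \<in> X \<longrightarrow> y \<notin> nbhd m a r t)" for a r t
  proof
    assume *: "avoids m X a r t"
    show "\<forall>y. restrict y {..<m} \<in> X \<longrightarrow> y \<notin> nbhd m a r t"
    proof (intro allI impI)
      fix y assume "restrict y {..<m} \<in> X"
      then have "restrict y {..<m} \<notin> nbhd m a r t" using * by (simp add: avoids_def)
      then show "y \<notin> nbhd m a r t" by (simp add: nbhd_def)
    qed
  next
    assume *: "\<forall>y. restrict y {..<m} \<in> X \<longrightarrow> y \<notin> nbhd m a r t"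
    show "avoids m X a r t"
      unfolding avoids_def
    proof
      fix x assume "x \<in> X"
      then have "restrict x {..<m} = x" using sub by (auto intro: extensional_restrict simp: PiE_def)
      then show "x \<notin> nbhd m a r t" using * \<open>x \<in> X\<close> by metis
    qed
  qed
  moreover have "config_definable M m (\<lambda>E s. \<forall>y. restrict y {..<m} \<in> X \<longrightarrow> y \<notin> nbhd m (E p) (\<tau> s) (\<sigma> s))"
  proof (rule config_all_point[where p="Suc p"])
    show "config_definable M m (\<lambda>E s. restrict (E (Suc p)) {..<m} \<in> X \<longrightarrow> E (Suc p) \<notin> nbhd m (E p) (\<tau> s) (\<sigma> s))"
      by (intro config_imp config_mem config_neg config_nbhd assms)
  qed simp
  ultimately show ?thesis by simp
qed

lemma config_sep_radius:
  assumes "definable_inf M m A" "definable_inf M m B" "group_term \<tau>" "\<And>s v. \<tau> (s(k := v)) = \<tau> s" "0 < k"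
  shows "config_definable M m (\<lambda>E s. sep_radius m L A B (s 0) (\<tau> s) (E p))"
proof -
  have pos: "config_definable M m (\<lambda>E s. 0 < \<tau> s)"
  proof -
    have "config_definable M m (\<lambda>E s. \<tau> s < \<tau> s + \<tau> s)" by (intro config_less group_term_plus assms)
    then show ?thesis by simp
  qed
  have fin: "finite {J. L \<subseteq> J \<and> J \<subseteq> {..<m}}"
    by (rule finite_subset[of _ "Pow {..<m}"]) auto
  have "config_definable M m (\<lambda>E s. \<exists>t. avoids m A (project J (E p)) (\<tau> s) t \<or> avoids m B (project J (E p)) (\<tau> s) t)" for J
  proof (rule config_ex_scalar[where k=k])
    show "config_definable M m (\<lambda>E s. avoids m A (project J (E p)) (\<tau> s) (s k) \<or> avoids m B (project J (E p)) (\<tau> s) (s k))"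
    proof (rule config_project[where \<Phi>="\<lambda>E s a. avoids m A a (\<tau> s) (s k) \<or> avoids m B a (\<tau> s) (s k)"])
      show "config_definable M m (\<lambda>E s. avoids m A (E p) (\<tau> s) (s k) \<or> avoids m B (E p) (\<tau> s) (s k))"
        by (intro config_disj config_avoids assms group_term_var)
    qed simp
  qed (simp add: assms(4))
  then show ?thesis
    unfolding sep_radius_def
    by (intro config_conj pos config_le assms group_term_var config_finite_all fin)
qed

lemma config_threshold:
  assumes "definable_inf M m A" "definable_inf M m B" "group_term \<sigma>" "\<And>s v. \<sigma> (s(k := v)) = \<sigma> s" "0 < k"
  shows "config_definable M m (\<lambda>E s. threshold m L A B (s 0) (E p) (\<sigma> s))"
  unfolding threshold_def
proof (rule config_all_scalar[where k=k])
  have pos: "config_definable M m (\<lambda>E s. 0 < s k)"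
  proof -
    have "config_definable M m (\<lambda>E s. s k < s k + s k)" by (intro config_less group_term_plus group_term_var)
    then show ?thesis by simp
  qed
  show "config_definable M m (\<lambda>E s. 0 < s k \<and> sep_radius m L A B (s 0) (s k + s k) (E p) \<longrightarrow> avoids m B (E p) (s k) (\<sigma> s))"
    by (intro config_imp config_conj pos config_sep_radius[where k="Suc k"] config_avoids assms group_term_plus group_term_var) auto
qed (use assms(4,5) in auto)

text \<open>
  Quantification over all functions instead of over the elements of \<open>A\<close> brings the definition into the form
  to which \<open>config_ex_point\<close> applies.
\<close>

lemma tube_iff_restrict:
  assumes "A \<subseteq> {..<m} \<rightarrow>\<^sub>E UNIV"
  shows "x \<in> tube m L A B u \<longleftrightarrow> (\<exists>a. restrict a {..<m} \<in> A \<and> (\<exists>r t. 0 < r \<and>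
     sep_radius m L A B u (eightfold r) a \<and>
     threshold m L A B u a t \<and> (\<forall>i\<in>{..<m}. a i = Infty \<or> \<not> Fin t < a i) \<and> x \<in> nbhd m a r (t + u)))"
    (is "_ \<longleftrightarrow> (\<exists>a. _ \<and> ?P a)")
proof -
  have av: "avoids m X (project J (restrict a {..<m})) = avoids m X (project J a)" for X J a
    by (intro ext avoids_local) auto
  have av': "avoids m X (restrict a {..<m}) = avoids m X a" for X a
    by (intro ext avoids_local) auto
  have nb: "nbhd m (restrict a {..<m}) = nbhd m a" for a
    by (intro ext) (auto simp: nbhd_def)
  have P: "?P (restrict a {..<m}) = ?P a" for a
    unfolding threshold_def sep_radius_def av av' nb by simp
  have "x \<in> tube m L A B u \<longleftrightarrow> (\<exists>a\<in>A. ?P a)" by (simp add: tube_def)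
  also have "\<dots> \<longleftrightarrow> (\<exists>a. restrict a {..<m} \<in> A \<and> ?P a)"
  proof
    assume "\<exists>a\<in>A. ?P a"
    then obtain a where a: "a \<in> A" "?P a" by blast
    then have "restrict a {..<m} = a" using assms by (auto intro: extensional_restrict simp: PiE_def)
    then have "restrict a {..<m} \<in> A" using a by simp
    then show "\<exists>a. restrict a {..<m} \<in> A \<and> ?P a" using a(2) by blast
  next
    assume "\<exists>a. restrict a {..<m} \<in> A \<and> ?P a"
    then obtain a where a: "restrict a {..<m} \<in> A" "?P a" by blast
    then have "?P (restrict a {..<m})" using P by blast
    then show "\<exists>a\<in>A. ?P a" using a(1) by blast
  qed
  finally show ?thesis .
qed

lemma config_tube:
  assumes "definable_inf M m A" "definable_inf M m B"
  shows "config_definable M m (\<lambda>E s. E 0 \<in> tube m L A B (s 0))"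
proof -
  have sub: "A \<subseteq> {..<m} \<rightarrow>\<^sub>E UNIV" using assms by (simp add: definable_inf_def)
  have pos: "config_definable M m (\<lambda>E s. 0 < s 1)"
  proof -
    have "config_definable M m (\<lambda>E s. s 1 < s 1 + s 1)" by (intro config_less group_term_plus group_term_var)
    then show ?thesis by simp
  qed
  have "config_definable M m (\<lambda>E s. 0 < s 1 \<and>
     sep_radius m L A B (s 0) (eightfold (s 1)) (E 1) \<and>
     threshold m L A B (s 0) (E 1) (s 2) \<and>
     (\<forall>i\<in>{..<m}. E 1 i = Infty \<or> \<not> Fin (s 2) < E 1 i) \<and> E 0 \<in> nbhd m (E 1) (s 1) (s 2 + s 0))"
    by (intro config_conj pos config_sep_radius[where k=3] config_threshold[where k=3] assms config_finite_all config_disj config_neg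
        config_infinite config_term_less_coordinate config_nbhd group_term_var group_term_plus) auto
  then have "config_definable M m (\<lambda>E s. \<exists>t. 0 < s 1 \<and>
     sep_radius m L A B (s 0) (eightfold (s 1)) (E 1) \<and>
     threshold m L A B (s 0) (E 1) t \<and>
     (\<forall>i\<in>{..<m}. E 1 i = Infty \<or> \<not> Fin t < E 1 i) \<and> E 0 \<in> nbhd m (E 1) (s 1) (t + s 0))"
    by (rule config_ex_scalar) simp
  then have "config_definable M m (\<lambda>E s. \<exists>r t. 0 < r \<and>
     sep_radius m L A B (s 0) (eightfold r) (E 1) \<and>
     threshold m L A B (s 0) (E 1) t \<and>
     (\<forall>i\<in>{..<m}. E 1 i = Infty \<or> \<not> Fin t < E 1 i) \<and> E 0 \<in> nbhd m (E 1) r (t + s 0))"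
    by (rule config_ex_scalar) simp
  then have "config_definable M m (\<lambda>E s. restrict (E 1) {..<m} \<in> A \<and> (\<exists>r t. 0 < r \<and>
     sep_radius m L A B (s 0) (eightfold r) (E 1) \<and>
     threshold m L A B (s 0) (E 1) t \<and>
     (\<forall>i\<in>{..<m}. E 1 i = Infty \<or> \<not> Fin t < E 1 i) \<and> E 0 \<in> nbhd m (E 1) r (t + s 0)))"
    by (intro config_conj config_mem assms)
  then show ?thesis
    unfolding tube_iff_restrict[OF sub] by (rule config_ex_point) simp
qed

text \<open>
  Let \<open>q\<close> be at least half of every \<open>s\<close> such that \<open>2s\<close> is separating at \<open>a\<close>, with \<open>2q\<close> separating itself.
  Some neighbourhood of \<open>a\<close> of radius \<open>2q\<close> then misses \<open>B\<close>, since it cannot miss \<open>A\<close>, and its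
  threshold serves all smaller radii.
\<close>

lemma threshold_exists:
  fixes M :: "('f, 'r, 'g::linordered_group_add) expansion"
  assumes om: "o_minimal M" and A: "definable_inf M m A" and B: "definable_inf M m B"
    and "a \<in> A" "sep_radius m L A B u r a" "L \<subseteq> {..<m}"
  shows "\<exists>t. threshold m L A B u a t"
proof -
  define P where "P s \<longleftrightarrow> 0 < s \<and> sep_radius m L A B u (s + s) a" for s
  have bound: "0 < s \<and> s \<le> u" if "P s" for s
  proof -
    have s: "0 < s" "s + s \<le> u"
      using that sep_radius_bounds(2) unfolding P_def by blast+
    then have "s \<le> s + s" by (simp add: order_less_imp_le)
    then show ?thesis using s order_trans by blast
  qed
  have "0 < r" by (rule sep_radius_bounds[OF assms(5)])
  then obtain s where "0 < s" "s + s \<le> r" using o_minimal_halving[OF om] by blast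
  then have Ps: "P s" using sep_radius_mono[OF assms(5)] by (simp add: P_def)
  \<comment> \<open>\<open>v < v + v\<close> expresses \<open>0 < v\<close> in the language, which has no constant for \<open>0\<close>.\<close>
  have defP: "definable M {0} {y \<in> {0} \<rightarrow>\<^sub>E UNIV. P (y 0)}"
  proof -
    have "config_definable M m (\<lambda>E s. s 1 < s 1 + s 1 \<and> sep_radius m L A B (s 0) (s 1 + s 1) (E 0))"
      by (intro config_conj config_less config_sep_radius[where k=2] A B group_term_plus group_term_var) auto
    then have "definable M {0} {y \<in> {0} \<rightarrow>\<^sub>E UNIV. y 0 < y 0 + y 0 \<and> sep_radius m L A B u (y 0 + y 0) a}"
      by (rule definable_of_config_scalar[where k=1 and E="\<lambda>_. a" and s="\<lambda>_. u"
            and \<Phi>="\<lambda>E s v. v < v + v \<and> sep_radius m L A B (s 0) (v + v) (E 0)"]) simp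
    then show ?thesis by (simp add: P_def)
  qed
  have "\<exists>q. P q \<and> (\<forall>s. P s \<longrightarrow> s \<le> q + q)"
    by (rule o_minimal_half_bound[where P=P, OF om defP _ Ps]) (rule bound)
  then obtain q where q: "P q" "\<And>s. P s \<Longrightarrow> s \<le> q + q" by blast
  obtain t where "avoids m A (project {..<m} a) (q + q) t \<or> avoids m B (project {..<m} a) (q + q) t"
    by (rule sep_radius_avoids[OF q(1)[unfolded P_def, THEN conjunct2] assms(6) order_refl])
  moreover have "avoids m X (project {..<m} a) (q + q) t = avoids m X a (q + q) t" for X
    by (rule avoids_local) simp
  moreover have "\<not> avoids m A a (q + q) t"
    using assms(4) nbhd_self[of "q + q" a m t] q(1) by (auto simp: avoids_def P_def)
  ultimately have "avoids m B a (q + q) t" by blast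
  then have "threshold m L A B u a t"
    unfolding threshold_def using avoids_mono[OF _ q(2) order_refl] P_def by blast
  then show ?thesis by blast
qed

lemma tube_superset:
  fixes M :: "('f, 'r, 'g::linordered_group_add) expansion"
  assumes om: "o_minimal M" and A: "definable_inf M m A" and B: "definable_inf M m B"
    and "L \<subseteq> {..<m}" "0 < u"
    and sep: "\<And>x J. x \<in> A \<Longrightarrow> L \<subseteq> J \<Longrightarrow> J \<subseteq> {..<m} \<Longrightarrow>
      \<exists>r>0. \<exists>t. avoids m A (project J x) r t \<or> avoids m B (project J x) r t"
  shows "A \<subseteq> tube m L A B u"
proof
  fix a assume a: "a \<in> A"
  have fin: "finite {J. L \<subseteq> J \<and> J \<subseteq> {..<m}}"
    by (rule finite_subset[of _ "Pow {..<m}"]) auto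
  have "\<exists>r>0. \<exists>t. \<forall>J\<in>{J. L \<subseteq> J \<and> J \<subseteq> {..<m}}.
      avoids m A (project J a) r t \<or> avoids m B (project J a) r t"
  proof (rule uniform_radius[OF fin \<open>0 < u\<close>])
    show "\<exists>r>0. \<exists>t. avoids m A (project J a) r t \<or> avoids m B (project J a) r t"
      if "J \<in> {J. L \<subseteq> J \<and> J \<subseteq> {..<m}}" for J
      using sep[OF a, of J] that by blast
  qed (use avoids_mono in blast)
  then obtain r t where r: "0 < r" "\<forall>J\<in>{J. L \<subseteq> J \<and> J \<subseteq> {..<m}}.
      avoids m A (project J a) r t \<or> avoids m B (project J a) r t" by blast
  define v where "v = min r u"
  have "sep_radius m L A B u v a"
  proof (rule sep_radiusI)
    show "0 < v" "v \<le> u" using r \<open>0 < u\<close> by (auto simp: v_def)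
    fix J assume "L \<subseteq> J" "J \<subseteq> {..<m}"
    then have "avoids m A (project J a) r t \<or> avoids m B (project J a) r t" using r(2) by blast
    then have "avoids m A (project J a) v t \<or> avoids m B (project J a) v t"
      using avoids_mono[of m _ "project J a" r t v t] unfolding v_def by fastforce
    then show "\<exists>t. avoids m A (project J a) v t \<or> avoids m B (project J a) v t" by (rule exI)
  qed
  note g = this
  obtain v1 where v1: "0 < v1" "v1 + v1 \<le> v"
    using o_minimal_halving[OF om sep_radius_bounds(1)[OF g]] .
  obtain v2 where v2: "0 < v2" "v2 + v2 \<le> v1" using o_minimal_halving[OF om v1(1)] .
  obtain v3 where v3: "0 < v3" "v3 + v3 \<le> v2" using o_minimal_halving[OF om v2(1)] .
  note v = v1 v2 v3
  have "eightfold v3 \<le> v"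
    by (intro order_trans[OF _ v(2)] order_trans[OF _ v(4)] group_add_mono v(6))
  then have g8: "sep_radius m L A B u (eightfold v3) a"
    using v by (intro sep_radius_mono[OF g]) simp_all
  obtain t0 where t0: "threshold m L A B u a t0"
    using threshold_exists[OF om A B a g \<open>L \<subseteq> {..<m}\<close>] by blast
  \<comment> \<open>Raising a threshold keeps it a threshold, so it may be chosen above all finite coordinates of \<open>a\<close>.\<close>
  define t where "t = Max (insert t0 ((\<lambda>i. the_fin (a i)) ` {..<m}))"
  have "t0 \<le> t" by (simp add: t_def)
  then have "threshold m L A B u a t"
    using t0 avoids_mono[OF _ order_refl] unfolding threshold_def by blast
  moreover have "a i = Infty \<or> \<not> Fin t < a i" if "i < m" for i
  proof (cases "a i")
    case (Fin \<alpha>)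
    then have "\<alpha> \<in> (\<lambda>i. the_fin (a i)) ` {..<m}" using that by force
    then have "\<alpha> \<le> t" by (simp add: t_def)
    then show ?thesis using Fin by auto
  qed simp
  moreover have "a \<in> nbhd m a v3 (t + u)" using v by (intro nbhd_self)
  ultimately show "a \<in> tube m L A B u"
    unfolding tube_def using a v(5) g8 by blast
qed

section \<open>The trivial group\<close>

lemma definable_trivial:
  assumes "\<forall>x::'g::linordered_group_add. x = 0" "S \<subseteq> L \<rightarrow>\<^sub>E (UNIV::'g set)"
  shows "definable M L S"
proof -
  have "x = y" if "x \<in> S" "y \<in> L \<rightarrow>\<^sub>E UNIV" for x y
  proof (rule PiE_ext)
    show "x \<in> L \<rightarrow>\<^sub>E UNIV" using that assms(2) by blast
    show "y \<in> L \<rightarrow>\<^sub>E UNIV" by fact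
    show "x i = y i" for i using assms(1) by metis
  qed
  then consider "S = {}" | "S = L \<rightarrow>\<^sub>E UNIV" using assms(2) by blast
  then show ?thesis
  proof cases
    case 1
    show ?thesis unfolding definable_def 1
      by (intro exI[of _ "Neg (Eq (Var 0) (Var 0))"]) simp
  next
    case 2
    show ?thesis unfolding definable_def 2
      by (intro exI[of _ "Eq (Var 0) (Var 0)"]) simp
  qed
qed

lemma definable_inf_trivial:
  assumes "\<forall>x::'g::linordered_group_add. x = 0" "X \<subseteq> {..<m} \<rightarrow>\<^sub>E (UNIV::'g with_infty set)"
  shows "definable_inf M m X"
  unfolding definable_inf_def
proof (intro conjI allI impI)
  show "X \<subseteq> {..<m} \<rightarrow>\<^sub>E UNIV" by fact
  show "definable M L (fin_proj L ` part_at m L X)" for L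
    by (rule definable_trivial[OF assms(1)]) (auto simp: fin_proj_def)
qed

text \<open>
  No interval contains a finite element of the trivial group, so the only neighbourhood of \<open>Fin 0\<close> is
  everything, whereas \<open>\<infinity>\<close> is an open point. Open sets are therefore upward closed.
\<close>

lemma open_upward_trivial:
  assumes triv: "\<forall>x::'g::linordered_group_add. x = 0"
    and U: "openin (top_inf_power m) U" and z: "z \<in> U"
    and y: "y \<in> {..<m} \<rightarrow>\<^sub>E UNIV" "\<And>i. i < m \<Longrightarrow> z i = Infty \<Longrightarrow> (y::'g point) i = Infty"
  shows "y \<in> U"
proof -
  obtain V where V: "z \<in> (\<Pi>\<^sub>E i\<in>{..<m}. V i)" "\<And>i. openin top_inf (V i)" "(\<Pi>\<^sub>E i\<in>{..<m}. V i) \<subseteq> U"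
    using product_topology_open_contains_basis[OF U[unfolded top_inf_power_def] z] by blast
  have full: "W = UNIV" if "openin top_inf W" "Fin a \<in> W" for W :: "'g with_infty set" and a
  proof -
    have "generate_topology_on (insert UNIV (range (\<lambda>a. {..<Fin a}) \<union>
        {{Fin a<..<Fin b} |a b. True} \<union> range (\<lambda>b. {Fin b<..}))) W"
      using that(1) by (simp add: top_inf_def openin_topology_generated_by_iff)
    then show ?thesis using that(2)
    proof induction
      case (Basis W)
      have "\<not> c < d" for c d :: 'g using triv by (metis less_irrefl)
      then show ?case using Basis by auto
    qed auto
  qed
  have "y i \<in> V i" if "i \<in> {..<m}" for i
  proof (cases "z i")
    case Infty
    then show ?thesis using y(2)[of i] V(1) that by (metis PiE_mem lessThan_iff)
  next
    case (Fin a)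
    then have "V i = UNIV" using full[OF V(2)] V(1) that by (metis PiE_mem)
    then show ?thesis by simp
  qed
  then have "y \<in> (\<Pi>\<^sub>E i\<in>{..<m}. V i)" using y(1) by (simp add: PiE_iff)
  then show ?thesis using V(3) by blast
qed

text \<open>
  The points of \<open>Z\<close> above \<open>z\<close> form the least neighbourhood of \<open>z\<close>. A nonempty closed subset of it contains
  \<open>z\<close>, so of two disjoint closed subsets one is empty. There are only finitely many points.
\<close>

lemma definably_normal_cover_trivial:
  assumes triv: "\<forall>x::'g::linordered_group_add. x = 0" and Z: "Z \<subseteq> {..<m} \<rightarrow>\<^sub>E (UNIV::'g with_infty set)"
  shows "\<exists>F. finite F \<and> \<Union>F = Z \<and>
           (\<forall>U\<in>F. openin (subtopology (top_inf_power m) Z) U \<and> definable_inf M m U \<and>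
                  definably_normal M m U)"
proof -
  define up where "up z = {y \<in> Z. \<forall>i<m. z i = Infty \<longrightarrow> y i = Infty}" for z :: "'g point"
  have upZ: "up z \<subseteq> {..<m} \<rightarrow>\<^sub>E UNIV" for z using Z by (auto simp: up_def)
  have "(UNIV :: 'g with_infty set) \<subseteq> {Fin 0, Infty}"
  proof
    fix x :: "'g with_infty" show "x \<in> {Fin 0, Infty}" using triv by (cases x) auto
  qed
  then have "finite (UNIV :: 'g with_infty set)" by (rule finite_subset) simp
  then have "finite Z" using Z by (meson finite_PiE finite_lessThan finite_subset)
  have "openin (subtopology (top_inf_power m) Z) (up z)" for z
  proof -
    have "openin top_inf {Infty :: 'g with_infty}"
    proof -
      have "basic Infty 0 0 = {Infty :: 'g with_infty}"
      proof (rule set_eqI)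
        fix y :: "'g with_infty" show "y \<in> basic Infty 0 0 \<longleftrightarrow> y \<in> {Infty}"
          using triv[rule_format, of "the_fin y"] by (cases y) (simp_all add: basic_def)
      qed
      then show ?thesis using openin_basic by metis
    qed
    moreover have "openin top_inf (UNIV :: 'g with_infty set)"
      by (metis openin_topspace topspace_top_inf)
    ultimately have "openin (top_inf_power m) (\<Pi>\<^sub>E i\<in>{..<m}. if z i = Infty then {Infty :: 'g with_infty} else UNIV)"
      unfolding top_inf_power_def by (simp add: openin_PiE)
    moreover have "up z = (\<Pi>\<^sub>E i\<in>{..<m}. if z i = Infty then {Infty} else UNIV) \<inter> Z"
    proof (rule set_eqI)
      fix y
      have "(y \<in> (\<Pi>\<^sub>E i\<in>{..<m}. if z i = Infty then {Infty} else UNIV)) \<longleftrightarrow>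
          (\<forall>i<m. z i = Infty \<longrightarrow> y i = Infty)" if "y \<in> Z"
        using subsetD[OF Z that] by (simp add: PiE_iff) blast
      then show "y \<in> up z \<longleftrightarrow> y \<in> (\<Pi>\<^sub>E i\<in>{..<m}. if z i = Infty then {Infty} else UNIV) \<inter> Z"
        unfolding up_def by blast
    qed
    ultimately show ?thesis unfolding openin_subtopology by blast
  qed
  moreover have "definable_inf M m (up z)" for z by (rule definable_inf_trivial[OF triv upZ])
  moreover have "definably_normal M m (up z)" if "z \<in> Z" for z
  proof -
    have zz: "z \<in> up z" using that by (simp add: up_def)
    let ?T = "subtopology (top_inf_power m) (up z)"
    have top: "topspace ?T = up z" using upZ by auto
    have least: "z \<in> A" if "closedin ?T A" "A \<noteq> {}" for A
    proof (rule ccontr)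
      assume "z \<notin> A"
      have "openin ?T (up z - A)" using that(1) top by (metis openin_diff openin_topspace)
      then obtain T where T: "openin (top_inf_power m) T" "up z - A = T \<inter> up z"
        by (auto simp: openin_subtopology)
      have "z \<in> T" using T(2) zz \<open>z \<notin> A\<close> by blast
      have "y \<in> T" if "y \<in> up z" for y
        by (rule open_upward_trivial[OF triv T(1) \<open>z \<in> T\<close>]) (use that upZ in \<open>auto simp: up_def\<close>)
      then have "up z - A = up z" using T(2) by blast
      moreover have "A \<subseteq> up z" using closedin_subset[OF that(1)] top by simp
      ultimately show False using \<open>A \<noteq> {}\<close> by blast
    qed
    have opens: "openin ?T {}" "openin ?T (up z)" using top by (auto, metis openin_topspace)
    have defs: "definable_inf M m {}" "definable_inf M m (up z)"
      by (rule definable_inf_trivial[OF triv]; use upZ in simp)+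
    show ?thesis
      unfolding definably_normal_def
    proof (intro conjI allI impI defs(2), elim conjE)
      fix A B
      assume AB: "closedin ?T A" "closedin ?T B" "A \<inter> B = {}"
      then have "A = {} \<or> B = {}" using least by blast
      have sub: "A \<subseteq> up z" "B \<subseteq> up z" using AB closedin_subset top by metis+
      from \<open>A = {} \<or> B = {}\<close>
      show "\<exists>U V. openin ?T U \<and> definable_inf M m U \<and> openin ?T V \<and> definable_inf M m V \<and>
          A \<subseteq> U \<and> B \<subseteq> V \<and> U \<inter> V = {}"
      proof
        assume "A = {}"
        then show ?thesis
          using opens defs sub by (intro exI[of _ "{}"] exI[of _ "up z"] conjI) auto
      next
        assume "B = {}"
        then show ?thesis
          using opens defs sub by (intro exI[of _ "up z"] exI[of _ "{}"] conjI) auto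
      qed
    qed
  qed
  moreover have "\<Union>(up ` Z) = Z" by (auto simp: up_def)
  ultimately show ?thesis using \<open>finite Z\<close> by (intro exI[of _ "up ` Z"]) blast
qed

section \<open>Covering a locally closed set\<close>

text \<open>
  In the example of the introduction, \<open>L = {0}\<close> removes the points \<open>(0, y)\<close>, whereas \<open>L = {0, 1}\<close>
  keeps them and removes all infinite points instead.
\<close>

definition tame_part :: "nat \<Rightarrow> 'g point set \<Rightarrow> 'g point set \<Rightarrow> nat set \<Rightarrow> 'g point set" where
  "tame_part m O' C L = {x \<in> C. (\<forall>i\<in>L. x i \<noteq> Infty) \<and>
     (\<forall>J\<in>{J. L \<subseteq> J \<and> J \<subseteq> {..<m}}. restrict (project J x) {..<m} \<in> O')}"

lemma restrict_point: "x \<in> {..<m} \<rightarrow>\<^sub>E UNIV \<Longrightarrow> restrict x {..<m} = x"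
  by (auto intro: extensional_restrict simp: PiE_def)

lemma definable_tame_part:
  assumes "definable_inf M m O'" "definable_inf M m C" "L \<subseteq> {..<m}"
  shows "definable_inf M m (tame_part m O' C L)"
proof -
  have fin: "finite {J. L \<subseteq> J \<and> J \<subseteq> {..<m}}" "finite L"
    using finite_subset[of _ "Pow {..<m}"] finite_subset[OF assms(3)] by auto
  have "config_definable M m (\<lambda>E s. restrict (project J (E 0)) {..<m} \<in> O')" for J
    by (rule config_project[where \<Phi>="\<lambda>E s a. restrict a {..<m} \<in> O'"]) (intro config_mem assms, simp)
  then have "config_definable M m (\<lambda>E s. restrict (E 0) {..<m} \<in> C \<and> (\<forall>i\<in>L. \<not> E 0 i = Infty) \<and>
     (\<forall>J\<in>{J. L \<subseteq> J \<and> J \<subseteq> {..<m}}. restrict (project J (E 0)) {..<m} \<in> O'))"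
    using assms(3) by (intro config_conj config_mem assms config_finite_all fin config_neg config_infinite) auto
  then have "definable_inf M m {x \<in> {..<m} \<rightarrow>\<^sub>E UNIV. restrict x {..<m} \<in> C \<and> (\<forall>i\<in>L. \<not> x i = Infty) \<and>
     (\<forall>J\<in>{J. L \<subseteq> J \<and> J \<subseteq> {..<m}}. restrict (project J x) {..<m} \<in> O')}"
    by (rule definable_inf_of_config[where p=0 and \<Phi>="\<lambda>s x. restrict x {..<m} \<in> C \<and> (\<forall>i\<in>L. \<not> x i = Infty) \<and>
     (\<forall>J\<in>{J. L \<subseteq> J \<and> J \<subseteq> {..<m}}. restrict (project J x) {..<m} \<in> O')"])
  moreover have "{x \<in> {..<m} \<rightarrow>\<^sub>E UNIV. restrict x {..<m} \<in> C \<and> (\<forall>i\<in>L. \<not> x i = Infty) \<and>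
     (\<forall>J\<in>{J. L \<subseteq> J \<and> J \<subseteq> {..<m}}. restrict (project J x) {..<m} \<in> O')} = tame_part m O' C L"
  proof -
    have "C \<subseteq> {..<m} \<rightarrow>\<^sub>E UNIV" using assms(2) by (simp add: definable_inf_def)
    then have "x \<in> {..<m} \<rightarrow>\<^sub>E UNIV \<and> restrict x {..<m} \<in> C \<longleftrightarrow> x \<in> C" for x
      using restrict_point[of x m] by (metis subsetD)
    then show ?thesis unfolding tame_part_def by blast
  qed
  ultimately show ?thesis by simp
qed

lemma restrict_project_eq:
  assumes "x \<in> {..<m} \<rightarrow>\<^sub>E UNIV" "{i. i < m \<and> x i \<noteq> Infty} \<subseteq> J"
  shows "restrict (project J x) {..<m} = x"
proof
  fix i
  show "restrict (project J x) {..<m} i = x i"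
    using assms PiE_arb[OF assms(1), of i] by (cases "i < m") auto
qed

lemma tame_part_subset:
  assumes "C \<subseteq> {..<m} \<rightarrow>\<^sub>E UNIV" "L \<subseteq> {..<m}"
  shows "tame_part m O' C L \<subseteq> O' \<inter> C"
proof
  fix x assume x: "x \<in> tame_part m O' C L"
  then have "x \<in> C" by (simp add: tame_part_def)
  have "restrict (project {..<m} x) {..<m} \<in> O'" using x assms(2) by (simp add: tame_part_def)
  moreover have "restrict (project {..<m} x) {..<m} = x"
    using assms(1) \<open>x \<in> C\<close> by (intro restrict_project_eq) auto
  ultimately show "x \<in> O' \<inter> C" using \<open>x \<in> C\<close> by simp
qed

lemma mem_tame_part:
  assumes "C \<subseteq> {..<m} \<rightarrow>\<^sub>E UNIV" "x \<in> O' \<inter> C"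
  shows "x \<in> tame_part m O' C {i. i < m \<and> x i \<noteq> Infty}"
  unfolding tame_part_def using assms restrict_project_eq[of x m] by auto

lemma openin_tame_part:
  fixes g :: "'g::linordered_group_add"
  assumes "0 < g" "openin (top_inf_power m) O'" "C \<subseteq> {..<m} \<rightarrow>\<^sub>E UNIV" "L \<subseteq> {..<m}"
  shows "openin (subtopology (top_inf_power m) (O' \<inter> C)) (tame_part m (O' :: 'g point set) C L)"
proof -
  let ?T = "tame_part m O' ({..<m} \<rightarrow>\<^sub>E UNIV) L"
  have fin: "finite {J. L \<subseteq> J \<and> J \<subseteq> {..<m}}"
    by (rule finite_subset[of _ "Pow {..<m}"]) auto
  have "openin (top_inf_power m) ?T"
    unfolding openin_iff_nbhd[OF assms(1)]
  proof (intro conjI ballI)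
    show "?T \<subseteq> {..<m} \<rightarrow>\<^sub>E UNIV" by (auto simp: tame_part_def)
    fix x assume x: "x \<in> ?T"
    have "\<exists>r>0. \<exists>t. \<forall>J\<in>{J. L \<subseteq> J \<and> J \<subseteq> {..<m}}.
        nbhd m (restrict (project J x) {..<m}) r t \<inter> ({..<m} \<rightarrow>\<^sub>E UNIV) \<subseteq> O'"
    proof (rule uniform_radius[OF fin assms(1)])
      show "\<exists>r>0. \<exists>t. nbhd m (restrict (project J x) {..<m}) r t \<inter> ({..<m} \<rightarrow>\<^sub>E UNIV) \<subseteq> O'"
        if "J \<in> {J. L \<subseteq> J \<and> J \<subseteq> {..<m}}" for J
        by (rule nbhd_in_open[OF assms(1,2)]) (use x that in \<open>simp add: tame_part_def\<close>)
      show "nbhd m (restrict (project J x) {..<m}) r' t' \<inter> ({..<m} \<rightarrow>\<^sub>E UNIV) \<subseteq> O'"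
        if "nbhd m (restrict (project J x) {..<m}) r t \<inter> ({..<m} \<rightarrow>\<^sub>E UNIV) \<subseteq> O'" "r' \<le> r" "t \<le> t'"
        for J r t r' t'
        using that(1) nbhd_mono[OF that(2,3), of m "restrict (project J x) {..<m}"] by blast
    qed
    then obtain r t where r: "0 < r" and rt: "\<And>J. L \<subseteq> J \<Longrightarrow> J \<subseteq> {..<m} \<Longrightarrow>
        nbhd m (restrict (project J x) {..<m}) r t \<inter> ({..<m} \<rightarrow>\<^sub>E UNIV) \<subseteq> O'" by blast
    have "y \<in> ?T" if y: "y \<in> nbhd m x r t" "y \<in> {..<m} \<rightarrow>\<^sub>E UNIV" for y
      unfolding tame_part_def
    proof (intro CollectI conjI ballI y)
      fix i assume "i \<in> L"
      then have "x i \<noteq> Infty" "y i \<in> basic (x i) r t"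
        using x y assms(4) by (auto simp: tame_part_def nbhd_def)
      then show "y i \<noteq> Infty" by (auto simp: basic_def)
    next
      fix J assume J: "J \<in> {J. L \<subseteq> J \<and> J \<subseteq> {..<m}}"
      have "restrict (project J y) {..<m} \<in> nbhd m (restrict (project J x) {..<m}) r t"
        using y(1) by (auto simp: nbhd_def basic_def)
      moreover have "restrict (project J y) {..<m} \<in> {..<m} \<rightarrow>\<^sub>E UNIV"
        by (rule restrict_PiE[THEN iffD2]) simp
      ultimately show "restrict (project J y) {..<m} \<in> O'" using rt[of J] J by blast
    qed
    then show "\<exists>r>0. \<exists>t. nbhd m x r t \<inter> ({..<m} \<rightarrow>\<^sub>E UNIV) \<subseteq> ?T" using r by blast
  qed
  moreover have "tame_part m O' C L = ?T \<inter> (O' \<inter> C)"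
    using tame_part_subset[OF assms(3,4), of O'] assms(3) by (auto simp: tame_part_def)
  ultimately show ?thesis by (auto simp: openin_subtopology)
qed

lemma avoids_closed:
  fixes g :: "'g::linordered_group_add"
  assumes "0 < g" "closedin (top_inf_power m) T" "X \<subseteq> T" "c \<in> {..<m} \<rightarrow>\<^sub>E UNIV" "c \<notin> T"
  shows "\<exists>r>0. \<exists>t. avoids m (X :: 'g point set) c r t"
proof -
  have "openin (top_inf_power m) (({..<m} \<rightarrow>\<^sub>E UNIV) - T)" "T \<subseteq> {..<m} \<rightarrow>\<^sub>E UNIV"
    using assms(2) by (auto simp: closedin_def)
  then obtain r t where "0 < r" "nbhd m c r t \<inter> ({..<m} \<rightarrow>\<^sub>E UNIV) \<subseteq> ({..<m} \<rightarrow>\<^sub>E UNIV) - T"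
    using nbhd_in_open[OF assms(1), of m "({..<m} \<rightarrow>\<^sub>E UNIV) - T" c] assms(4,5) by blast
  moreover from this have "avoids m X c r t"
    using assms(3) \<open>T \<subseteq> _\<close> unfolding avoids_def by blast
  ultimately show ?thesis by blast
qed

lemma project_tame_part:
  assumes "x \<in> tame_part m O' C L" "L \<subseteq> J" "J \<subseteq> {..<m}" "restrict (project J x) {..<m} \<in> C"
  shows "restrict (project J x) {..<m} \<in> tame_part m O' C L"
  unfolding tame_part_def
proof (intro CollectI conjI ballI assms(4))
  fix i assume "i \<in> L"
  then show "restrict (project J x) {..<m} i \<noteq> Infty"
    using assms(1-3) by (auto simp: tame_part_def)
next
  fix K assume K: "K \<in> {K. L \<subseteq> K \<and> K \<subseteq> {..<m}}"
  have "L \<subseteq> J \<inter> K" "J \<inter> K \<subseteq> {..<m}" using assms(2,3) K by blast+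
  then have "restrict (project (J \<inter> K) x) {..<m} \<in> O'"
    using assms(1) unfolding tame_part_def by blast
  moreover have "restrict (project K (restrict (project J x) {..<m})) {..<m} = restrict (project (J \<inter> K) x) {..<m}"
    by (auto simp: fun_eq_iff restrict_def)
  ultimately show "restrict (project K (restrict (project J x) {..<m})) {..<m} \<in> O'" by simp
qed

text \<open>
  The projected point \<open>c\<close> is either outside \<open>C\<close>, which contains \<open>A\<close> and \<open>B\<close> and is closed, or it belongs to
  the tame part again, where \<open>A\<close> and \<open>B\<close> are disjoint and closed. This is the step that fails for \<open>Z\<close> itself.
\<close>

lemma tame_part_separates:
  fixes g :: "'g::linordered_group_add"
  defines "W \<equiv> \<lambda>m O' C L. subtopology (top_inf_power m) (tame_part m (O' :: 'g point set) C L)"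
  assumes "0 < g" and C: "closedin (top_inf_power m) C" and "L \<subseteq> {..<m}"
    and A: "closedin (W m O' C L) A" and B: "closedin (W m O' C L) B" and "A \<inter> B = {}"
    and x: "x \<in> tame_part m O' C L" and J: "L \<subseteq> J" "J \<subseteq> {..<m}"
  shows "\<exists>r>0. \<exists>t. avoids m A (project J x) r t \<or> avoids m B (project J x) r t"
proof -
  let ?W = "tame_part m O' C L"
  let ?c = "restrict (project J x) {..<m}"
  have c: "?c \<in> {..<m} \<rightarrow>\<^sub>E UNIV" by simp
  have sub: "A \<subseteq> ?W" "B \<subseteq> ?W" "?W \<subseteq> C"
    using closedin_subset[OF A] closedin_subset[OF B] by (auto simp: W_def tame_part_def)
  have avoid: "\<exists>r>0. \<exists>t. avoids m X ?c r t"
    if X: "closedin (W m O' C L) X" "?c \<notin> X" "?c \<in> ?W" for X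
  proof -
    obtain T where "closedin (top_inf_power m) T" "X = T \<inter> ?W"
      using X(1) unfolding W_def closedin_subtopology by blast
    then show ?thesis using avoids_closed[OF assms(2) _ _ c, of T X] X(2,3) by blast
  qed
  have "(\<exists>r>0. \<exists>t. avoids m A ?c r t) \<or> (\<exists>r>0. \<exists>t. avoids m B ?c r t)"
  proof (cases "?c \<in> C")
    case True
    then have "?c \<in> ?W" using project_tame_part[OF x J] by blast
    moreover have "?c \<notin> A \<or> ?c \<notin> B" using assms(7) by blast
    ultimately show ?thesis using avoid A B by blast
  next
    case False
    then show ?thesis using avoids_closed[OF assms(2) C _ c, of A] sub by blast
  qed
  moreover have "avoids m X ?c r t = avoids m X (project J x) r t" for X r t
    by (rule avoids_local) simp
  ultimately show ?thesis by auto
qed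

lemma definably_normal_tame_part:
  fixes M :: "('f, 'r, 'g::linordered_group_add) expansion"
  assumes om: "o_minimal M" and u: "0 < (u::'g)"
    and O: "definable_inf M m O'" and C: "closedin (top_inf_power m) C" "definable_inf M m C"
    and L: "L \<subseteq> {..<m}"
  shows "definably_normal M m (tame_part m O' C L)"
proof -
  let ?W = "tame_part m O' C L"
  let ?X = "subtopology (top_inf_power m) ?W"
  have W: "definable_inf M m ?W" using definable_tame_part[OF O C(2) L] .
  have Wsub: "?W \<subseteq> {..<m} \<rightarrow>\<^sub>E UNIV" using W by (simp add: definable_inf_def)
  show ?thesis
    unfolding definably_normal_def
  proof (intro conjI W allI impI, elim conjE)
    fix A B
    assume A: "closedin ?X A" "definable_inf M m A" and B: "closedin ?X B" "definable_inf M m B"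
      and AB: "A \<inter> B = {}"
    have sub: "A \<subseteq> ?W" "B \<subseteq> ?W"
      using closedin_subset[OF A(1)] closedin_subset[OF B(1)] by auto
    have tube_ok: "openin ?X (tube m L A' B' u \<inter> ?W) \<and> definable_inf M m (tube m L A' B' u \<inter> ?W)"
      if "definable_inf M m A'" "definable_inf M m B'" for A' B'
    proof
      have "tube m L A' B' u \<inter> ?W = (tube m L A' B' u \<inter> ({..<m} \<rightarrow>\<^sub>E UNIV)) \<inter> ?W"
        using Wsub by blast
      then show "openin ?X (tube m L A' B' u \<inter> ?W)"
        unfolding openin_subtopology using openin_tube by (intro exI conjI)
      have "config_definable M m (\<lambda>E s. E 0 \<in> tube m L A' B' (s 0) \<and> restrict (E 0) {..<m} \<in> ?W)"
        by (intro config_conj config_tube config_mem W that)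
      from definable_inf_of_config[where \<Phi>="\<lambda>s x. x \<in> tube m L A' B' (s 0) \<and> restrict x {..<m} \<in> ?W" and s="\<lambda>_. u", OF this]
      have "definable_inf M m {x \<in> {..<m} \<rightarrow>\<^sub>E UNIV. x \<in> tube m L A' B' u \<and> restrict x {..<m} \<in> ?W}" .
      moreover have "{x \<in> {..<m} \<rightarrow>\<^sub>E UNIV. x \<in> tube m L A' B' u \<and> restrict x {..<m} \<in> ?W} = tube m L A' B' u \<inter> ?W"
      proof (rule set_eqI)
        fix x
        have "x \<in> {..<m} \<rightarrow>\<^sub>E UNIV \<and> restrict x {..<m} \<in> ?W \<longleftrightarrow> x \<in> ?W"
          by (cases "x \<in> {..<m} \<rightarrow>\<^sub>E UNIV") (use restrict_point[of x m] Wsub in \<open>simp, blast\<close>)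
        then show "x \<in> {x \<in> {..<m} \<rightarrow>\<^sub>E UNIV. x \<in> tube m L A' B' u \<and> restrict x {..<m} \<in> ?W} \<longleftrightarrow>
            x \<in> tube m L A' B' u \<inter> ?W" by blast
      qed
      ultimately show "definable_inf M m (tube m L A' B' u \<inter> ?W)" by simp
    qed
    have sep: "\<exists>r>0. \<exists>t. avoids m A (project J x) r t \<or> avoids m B (project J x) r t"
      if "x \<in> ?W" "L \<subseteq> J" "J \<subseteq> {..<m}" for x J
      by (rule tame_part_separates[OF u C(1) L A(1) B(1) AB that])
    have "A \<subseteq> tube m L A B u"
      by (rule tube_superset[OF om A(2) B(2) L u]) (use sep sub in blast)
    moreover have "B \<subseteq> tube m L B A u"
    proof (rule tube_superset[OF om B(2) A(2) L u])
      fix x J assume "x \<in> B" "L \<subseteq> J" "J \<subseteq> {..<m}"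
      then have "\<exists>r>0. \<exists>t. avoids m A (project J x) r t \<or> avoids m B (project J x) r t"
        using sep sub by blast
      then show "\<exists>r>0. \<exists>t. avoids m B (project J x) r t \<or> avoids m A (project J x) r t"
        by (simp only: disj_commute)
    qed
    moreover have "tube m L A B u \<inter> tube m L B A u = {}"
      by (rule tubes_disjoint[OF L]) (use sub in \<open>auto simp: tame_part_def\<close>)
    ultimately show "\<exists>U V. openin ?X U \<and> definable_inf M m U \<and> openin ?X V \<and> definable_inf M m V \<and>
        A \<subseteq> U \<and> B \<subseteq> V \<and> U \<inter> V = {}"
      using tube_ok[OF A(2) B(2)] tube_ok[OF B(2) A(2)] sub
      by (intro exI[of _ "tube m L A B u \<inter> ?W"] exI[of _ "tube m L B A u \<inter> ?W"]) blast
  qed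
qed

theorem theorem4p28:
  fixes M :: "('f, 'r, 'g::linordered_group_add) expansion"
    and m :: nat
    and Z :: "(nat \<Rightarrow> 'g with_infty) set"
  assumes "o_minimal M"
    and "definably_locally_closed M m Z"
  shows "\<exists>F. finite F \<and> \<Union>F = Z \<and>
           (\<forall>U\<in>F. openin (subtopology (top_inf_power m) Z) U \<and> definable_inf M m U \<and>
                  definably_normal M m U)"
proof -
  obtain O' C where O: "openin (top_inf_power m) O'" "definable_inf M m O'"
    and C: "closedin (top_inf_power m) C" "definable_inf M m C" and Z: "Z = O' \<inter> C"
    using assms(2) unfolding definably_locally_closed_def by blast
  have Csub: "C \<subseteq> {..<m} \<rightarrow>\<^sub>E UNIV" using C(2) by (simp add: definable_inf_def)
  show ?thesis
  proof (cases "\<forall>x::'g. x = 0")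
    case True
    then show ?thesis using Csub Z by (intro definably_normal_cover_trivial) auto
  next
    case False
    then obtain x :: 'g where "x \<noteq> 0" by blast
    then consider "0 < x" | "x < 0" by (meson linorder_neqE)
    then obtain g :: 'g where g: "0 < g"
    proof cases
      case 2
      then have "0 < - x" using group_less_left[of "- x" x 0] by simp
      then show ?thesis using that by blast
    qed
    let ?F = "tame_part m O' C ` Pow {..<m}"
    have "\<Union>?F = Z"
    proof
      show "\<Union>?F \<subseteq> Z" using tame_part_subset[OF Csub] Z by blast
      show "Z \<subseteq> \<Union>?F"
      proof
        fix x assume "x \<in> Z"
        then have "x \<in> tame_part m O' C {i. i < m \<and> x i \<noteq> Infty}"
          using mem_tame_part[OF Csub] Z by blast
        then show "x \<in> \<Union>?F" by (rule UN_I[rotated]) blast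
      qed
    qed
    moreover have "openin (subtopology (top_inf_power m) Z) U \<and> definable_inf M m U \<and> definably_normal M m U"
      if U: "U \<in> ?F" for U
    proof -
      obtain L where L: "L \<subseteq> {..<m}" "U = tame_part m O' C L" using U by blast
      show ?thesis unfolding L(2) Z
        by (intro conjI openin_tame_part[OF g O(1) Csub L(1)] definable_tame_part[OF O(2) C(2) L(1)]
            definably_normal_tame_part[OF assms(1) g O(2) C L(1)])
    qed
    ultimately show ?thesis by (intro exI[of _ ?F]) auto
  qed
qed

end
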